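(* Let $P$ be a Markov transition kernel on a general state space $(\mathsf{X},\mathcal{B}(\mathsf{X}))$. Assume that the associated Markov chain $X=\{X_n: n=0,1,2,\ldots\}$ is $\pi$-irreducible and positive Harris recurrent, where $\pi$ is the invariant probability measure. Assume further that there exist a set $C\in\mathcal{B}(\mathsf{X})$ with $\pi(C)>0$, a number $\varepsilon>0$ and a probability measure $\nu$ on $\mathcal{B}(\mathsf{X})$ such that the one-step minorization condition $P(x,A)\ge\varepsilon\,\nu(A)$ holds for all $x\in C$ and all $A\in\mathcal{B}(\mathsf{X})$. Let $X'=\{(X_n,\delta_n)\}$ be the associated split chain, $\alpha=C\times\{1\}$, and $\tau_\alpha=\min\{n\ge1:(X_n,\delta_n)\in\alpha\}$. For $t\in\mathbb{N}=\{1,2,3,\ldots\}$ and $A\in\mathcal{B}(\mathsf{X})$ put $$p_t=\frac{\Pr_\alpha(\tau_\alpha\ge t)}{\mathrm{E}_\alpha(\tau_\alpha)},\qquad Q_t(A)=\Pr_\alpha(X_t\in A\mid\tau_\alpha\ge t),$$ where $\Pr_\alpha$ and $\mathrm{E}_\alpha$ denote probability and expectation for the split chain conditional on $(X_0,\delta_0)\in\alpha$. Then for every $A\in\mathcal{B}(\mathsf{X})$, $$\pi(A)=\sum_{t=1}^{\infty}Q_t(A)\,p_t .$$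
   Context: Split chain. Given the minorization condition $P(x,\cdot)\ge\varepsilon\nu(\cdot)$ for $x\in C$, define for $x\in C$ the residual measure $R(x,\cdot)=(1-\varepsilon)^{-1}\big(P(x,\cdot)-\varepsilon\nu(\cdot)\big)$ (with $R(x,\cdot):=0$ if $\varepsilon=1$), so that $P(x,\cdot)=\varepsilon\nu(\cdot)+(1-\varepsilon)R(x,\cdot)$ on $C$. The split chain $X'=\{(X_n,\delta_n):n=0,1,\ldots\}$ is the Markov chain on $\mathsf{X}\times\{0,1\}$ with transition kernel $P'$ given, for $A\in\mathcal{B}(\mathsf{X})$ and $\delta\in\{0,1\}$, by $$P'[(x,0),A\times\{\delta\}]=\begin{cases}[\varepsilon\delta+(1-\varepsilon)(1-\delta)]\,P(x,A),& x\notin C,\\ [\varepsilon\delta+(1-\varepsilon)(1-\delta)]\,R(x,A),& x\in C,\end{cases}$$ $$P'[(x,1),A\times\{\delta\}]=\begin{cases}[\varepsilon\delta+(1-\varepsilon)(1-\delta)]\,P(x,A),& x\notin C,\\ [\varepsilon\delta+(1-\varepsilon)(1-\delta)]\,\nu(A),& x\in C.\end{cases}$$ (When $\varepsilon=1$, states $(x,0)$ are never entered.) Since the transition law out of any point of $\alpha=C\times\{1\}$ is the same (it is $X_1\sim\nu$ with, independently, $\delta_1\sim\mathrm{Bernoulli}(\varepsilon)$), conditioning on $(X_0,\delta_0)\in\alpha$ is unambiguous and amounts to starting with $X_1\sim\nu$. Under the stated hypotheses $\mathrm{E}_\alpha(\tau_\alpha)<\infty$, so $p_t$ is well defined, and $\{p_t\}$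 is a nonincreasing nonnegative sequence summing to one. If $\Pr_\alpha(\tau_\alpha\ge t)=0$, then $p_t=0$ and the term $Q_t(A)p_t$ is interpreted as $0$. *)

theory Defs
  imports "HOL-Probability.Probability"
begin

text \<open>
  A Markov kernel on the measurable space \<open>M\<close> is an element of \<open>M \<rightarrow>\<^sub>M prob_algebra M\<close>.
  The law on path space of the chain with initial law \<open>\<mu>\<close> and transition kernel \<open>K\<close> is
  the limit measure provided by the Ionescu-Tulcea theorem.
\<close>

definition path_law ::
    "'s measure \<Rightarrow> ('s \<Rightarrow> 's measure) \<Rightarrow> 's measure \<Rightarrow> (nat \<Rightarrow> 's) measure" where
  "path_law M K \<mu> =
     projective_family.lim UNIV
       (Ionescu_Tulcea.CI (\<lambda>n \<omega>. case n of 0 \<Rightarrow> \<mu> | Suc m \<Rightarrow> K (\<omega> m)) (\<lambda>_. M)) (\<lambda>_. M)"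

definition irreducible_chain :: "'s measure \<Rightarrow> ('s \<Rightarrow> 's measure) \<Rightarrow> 's measure \<Rightarrow> bool" where
  "irreducible_chain M K \<psi> \<longleftrightarrow>
     (\<forall>A\<in>sets M. emeasure \<psi> A > 0 \<longrightarrow>
        (\<forall>x\<in>space M. \<P>(\<omega> in path_law M K (return M x). \<exists>n\<ge>1. \<omega> n \<in> A) > 0))"

text \<open>
  Harris recurrence with respect to an irreducibility measure \<open>\<psi>\<close>: every set of positive
  \<open>\<psi>\<close>-measure is visited infinitely often, almost surely, from each of its points.
\<close>

definition harris_recurrent :: "'s measure \<Rightarrow> ('s \<Rightarrow> 's measure) \<Rightarrow> 's measure \<Rightarrow> bool" where
  "harris_recurrent M K \<psi> \<longleftrightarrow>
     irreducible_chain M K \<psi> \<and>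
     (\<forall>A\<in>sets M. emeasure \<psi> A > 0 \<longrightarrow>
        (\<forall>x\<in>A. \<P>(\<omega> in path_law M K (return M x). \<exists>\<^sub>\<infinity>n. \<omega> n \<in> A) = 1))"

definition invariant_prob :: "'s measure \<Rightarrow> ('s \<Rightarrow> 's measure) \<Rightarrow> 's measure \<Rightarrow> bool" where
  "invariant_prob M K \<pi> \<longleftrightarrow> \<pi> \<in> space (prob_algebra M) \<and> \<pi> \<bind> K = \<pi>"

text \<open>
  The process \<open>Z\<close> on the probability space \<open>\<Omega>\<close> is a Markov chain (with arbitrary initial law)
  with transition kernel \<open>K\<close>. The displayed identity is the defining property of
  \<open>Pr (Z (n+1) \<in> B | Z 0, \<dots>, Z n) = K (Z n) B\<close>. It also makes sense for a kernel that is
  defective at states the chain never enters, as the split kernel is when \<open>\<epsilon> = 1\<close>.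
\<close>

definition markov_chain ::
    "'w measure \<Rightarrow> (nat \<Rightarrow> 'w \<Rightarrow> 's) \<Rightarrow> 's measure \<Rightarrow> ('s \<Rightarrow> 's measure) \<Rightarrow> bool" where
  "markov_chain \<Omega> Z S K \<longleftrightarrow>
     prob_space \<Omega> \<and>
     (\<forall>n. Z n \<in> \<Omega> \<rightarrow>\<^sub>M S) \<and>
     (\<forall>n. \<forall>H\<in>sets (Pi\<^sub>M {..n} (\<lambda>_. S)). \<forall>B\<in>sets S.
        emeasure \<Omega> {\<omega>\<in>space \<Omega>. (\<lambda>i\<in>{..n}. Z i \<omega>) \<in> H \<and> Z (Suc n) \<omega> \<in> B} =
        (\<integral>\<^sup>+\<omega>. indicator H (\<lambda>i\<in>{..n}. Z i \<omega>) * emeasure (K (Z n \<omega>)) B \<partial>\<Omega>))"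

text \<open>
  For a Markov kernel, the coordinate process under \<open>path_law\<close> is a Markov chain in this sense.
\<close>

lemma markov_chain_path_law:
  assumes K: "K \<in> M \<rightarrow>\<^sub>M prob_algebra M" and mu: "\<mu> \<in> space (prob_algebra M)"
  shows "markov_chain (path_law M K \<mu>) (\<lambda>n \<omega>. \<omega> n) M K"
    and "distr (path_law M K \<mu>) M (\<lambda>\<omega>. \<omega> 0) = \<mu>"
proof -
  let ?K = "\<lambda>n \<omega>. case n of 0 \<Rightarrow> \<mu> | Suc m \<Rightarrow> K (\<omega> m)"
  have K': "K \<in> M \<rightarrow>\<^sub>M subprob_algebra M" using K by (rule measurable_prob_algebraD)
  have mu': "\<mu> \<in> space (subprob_algebra M)" "prob_space \<mu>" "sets \<mu> = sets M"
    using mu by (auto simp: space_prob_algebra space_subprob_algebra prob_space_imp_subprob_space)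
  have pK: "prob_space (K x)" "sets (K x) = sets M" "space (K x) = space M" if "x \<in> space M" for x
    using measurable_space[OF K that] by (auto simp: space_prob_algebra dest: sets_eq_imp_space_eq)
  interpret IT: Ionescu_Tulcea ?K "\<lambda>_. M"
  proof (rule Ionescu_Tulcea.intro, goal_cases)
    case (1 i)
    show ?case
    proof (cases i)
      case 0 then show ?thesis using mu' by simp
    next
      case (Suc m)
      have "(\<lambda>\<omega>. \<omega> m) \<in> measurable (PiM {0..<Suc m} (\<lambda>_. M)) M" by simp
      from measurable_compose[OF this K'] show ?thesis using Suc by simp
    qed
  next
    case (2 i x)
    show ?case
    proof (cases i)
      case 0 then show ?thesis using mu'(2) by simp
    next
      case (Suc m)
      have "x m \<in> space M" using 2 Suc by (simp add: space_PiM PiE_iff)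
      from pK(1)[OF this] show ?thesis using Suc by simp
    qed
  qed
  let ?L = "path_law M K \<mu>"
  have L: "?L = IT.PF.lim" by (simp add: path_law_def)
  have sL: "sets ?L = sets (PiM UNIV (\<lambda>_. M))" by (simp add: L)
  have spL: "space ?L = space (PiM UNIV (\<lambda>_. M))" using sL by (rule sets_eq_imp_space_eq)
  note [measurable_cong] = sL
  have Cm: "distr ?L (PiM {0..<m} (\<lambda>_. M)) (\<lambda>x. restrict x {0..<m}) = IT.C 0 m (\<lambda>_. undefined)" for m
  proof -
    have "IT.up_to {0..<m} = m"
    proof -
      have "IT.up_to {0..<m} \<le> k \<longleftrightarrow> m \<le> k" for k
        by (subst IT.up_to_iff_Ico) auto
      then show ?thesis by (meson order_refl antisym)
    qed
    moreover have "distr (IT.C 0 m (\<lambda>_. undefined)) (PiM {0..<m} (\<lambda>_. M)) (\<lambda>x. restrict x {0..<m}) = IT.C 0 m (\<lambda>_. undefined)"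
      using IT.distr_C[of m m "\<lambda>_. undefined" 0] by simp
    ultimately show ?thesis
      unfolding L by (subst IT.distr_lim) (auto simp: IT.CI_def)
  qed
  interpret prob_space ?L
  proof (rule prob_space_distrD)
    show "prob_space (distr ?L (PiM {0..<0} (\<lambda>_. M)) (\<lambda>x. restrict x {0..<0}))"
      unfolding Cm by (rule IT.prob_space_C) simp
    show "(\<lambda>x. restrict x {0..<0}) \<in> ?L \<rightarrow>\<^sub>M PiM {0..<0} (\<lambda>_. M)" by (auto intro!: measurable_restrict)
  qed
  have step: "emeasure ?L {\<omega>\<in>space ?L. restrict \<omega> {0..<m} \<in> H \<and> \<omega> m \<in> B} =
      (\<integral>\<^sup>+\<omega>. indicator H (restrict \<omega> {0..<m}) * emeasure (?K m (restrict \<omega> {0..<m})) B \<partial>?L)"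
    if H: "H \<in> sets (PiM {0..<m} (\<lambda>_. M))" and B: "B \<in> sets M" for m H B
  proof -
    let ?S = "PiM {0..<Suc m} (\<lambda>_. M)" let ?T = "PiM {0..<m} (\<lambda>_. M)"
    define D where "D = {\<omega>\<in>space ?S. restrict \<omega> {0..<m} \<in> H \<and> \<omega> m \<in> B}"
    have r: "(\<lambda>\<omega>. restrict \<omega> {0..<m}) \<in> ?S \<rightarrow>\<^sub>M ?T" by (rule measurable_restrict_subset) auto
    have D: "D \<in> sets ?S"
    proof -
      have "D = ((\<lambda>\<omega>. restrict \<omega> {0..<m}) -` H \<inter> space ?S) \<inter> ((\<lambda>\<omega>. \<omega> m) -` B \<inter> space ?S)"
        by (auto simp: D_def)
      moreover have c: "(\<lambda>\<omega>. \<omega> m) \<in> ?S \<rightarrow>\<^sub>M M" by simp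
      ultimately show ?thesis using sets.Int[OF measurable_sets[OF r H] measurable_sets[OF c B]] by (simp only:)
    qed
    have rL: "(\<lambda>\<omega>. restrict \<omega> {0..<k}) \<in> ?L \<rightarrow>\<^sub>M PiM {0..<k} (\<lambda>_. M)" for k
      by (auto intro!: measurable_restrict)
    have "{\<omega>\<in>space ?L. restrict \<omega> {0..<m} \<in> H \<and> \<omega> m \<in> B} = (\<lambda>\<omega>. restrict \<omega> {0..<Suc m}) -` D \<inter> space ?L"
    proof -
      have "{0..<Suc m} \<inter> {0..<m} = {0..<m}" by auto
      then show ?thesis by (auto simp: D_def spL space_PiM PiE_iff)
    qed
    then have "emeasure ?L {\<omega>\<in>space ?L. restrict \<omega> {0..<m} \<in> H \<and> \<omega> m \<in> B} =
       emeasure (distr ?L ?S (\<lambda>\<omega>. restrict \<omega> {0..<Suc m})) D"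
      using D rL by (simp add: emeasure_distr)
    also have "\<dots> = emeasure (IT.C 0 m (\<lambda>_. undefined) \<bind> IT.eP m) D"
      unfolding Cm by simp
    also have "\<dots> = (\<integral>\<^sup>+\<omega>. emeasure (IT.eP m \<omega>) D \<partial>IT.C 0 m (\<lambda>_. undefined))"
      using D by (intro emeasure_bind[where N="?S"])
        (auto simp: IT.space_C prob_space.not_empty[OF IT.prob_space_C] measurable_cong_sets[OF IT.sets_C] intro: IT.measurable_eP)
    also have "\<dots> = (\<integral>\<^sup>+\<omega>. indicator H \<omega> * emeasure (?K m \<omega>) B \<partial>IT.C 0 m (\<lambda>_. undefined))"
    proof (rule nn_integral_cong)
      fix \<omega> assume "\<omega> \<in> space (IT.C 0 m (\<lambda>_. undefined))"
      then have w: "\<omega> \<in> space ?T" by (simp add: IT.space_C)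
      have "(\<lambda>x. fun_upd \<omega> m x) -` D \<inter> space M = (if \<omega> \<in> H then B else {})"
      proof -
        have "restrict (fun_upd \<omega> m x) {0..<m} = \<omega>" for x
          using w by (auto simp: space_PiM PiE_iff extensional_def restrict_def fun_eq_iff)
        moreover have "fun_upd \<omega> m x \<in> space ?S" if "x \<in> space M" for x
          using w that by (auto simp: space_PiM PiE_iff extensional_def)
        ultimately show ?thesis using sets.sets_into_space[OF B] by (auto simp: D_def)
      qed
      then show "emeasure (IT.eP m \<omega>) D = indicator H \<omega> * emeasure (?K m \<omega>) B"
        using w D by (simp add: IT.emeasure_eP)
    qed
    also have "\<dots> = (\<integral>\<^sup>+\<omega>. indicator H \<omega> * emeasure (?K m \<omega>) B \<partial>distr ?L ?T (\<lambda>\<omega>. restrict \<omega> {0..<m}))"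
      by (simp add: Cm)
    also have "\<dots> = (\<integral>\<^sup>+\<omega>. indicator H (restrict \<omega> {0..<m}) * emeasure (?K m (restrict \<omega> {0..<m})) B \<partial>?L)"
      using H B IT.P[of m]
      by (intro nn_integral_distr rL borel_measurable_times_ennreal borel_measurable_indicator
            measurable_emeasure_kernel) auto
    finally show ?thesis .
  qed
  show "markov_chain ?L (\<lambda>n \<omega>. \<omega> n) M K"
    unfolding markov_chain_def
  proof (intro conjI allI ballI)
    show "prob_space ?L" by (rule prob_space_axioms)
    show "(\<lambda>\<omega>. \<omega> n) \<in> ?L \<rightarrow>\<^sub>M M" for n by simp
    fix n :: nat and H B assume "H \<in> sets (Pi\<^sub>M {..n} (\<lambda>_. M))" "B \<in> sets M"
    moreover have "{..n} = {0..<Suc n}" by auto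
    ultimately show "emeasure ?L {\<omega>\<in>space ?L. (\<lambda>i\<in>{..n}. \<omega> i) \<in> H \<and> \<omega> (Suc n) \<in> B} =
        (\<integral>\<^sup>+\<omega>. indicator H (\<lambda>i\<in>{..n}. \<omega> i) * emeasure (K (\<omega> n)) B \<partial>?L)"
      using step[of H "Suc n" B] by simp
  qed
  show "distr ?L M (\<lambda>\<omega>. \<omega> 0) = \<mu>"
  proof (rule measure_eqI)
    fix B assume "B \<in> sets (distr ?L M (\<lambda>\<omega>. \<omega> 0))"
    then have B: "B \<in> sets M" by simp
    have "(\<lambda>\<omega>. \<omega> 0) -` B \<inter> space ?L =
       {\<omega>\<in>space ?L. restrict \<omega> {0..<0} \<in> space (PiM {0..<0} (\<lambda>_. M)) \<and> \<omega> 0 \<in> B}"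
      by (auto simp: space_PiM)
    then have "emeasure (distr ?L M (\<lambda>\<omega>. \<omega> 0)) B =
       emeasure ?L {\<omega>\<in>space ?L. restrict \<omega> {0..<0} \<in> space (PiM {0..<0} (\<lambda>_. M)) \<and> \<omega> 0 \<in> B}"
      using B by (simp add: emeasure_distr)
    also have "\<dots> = emeasure \<mu> B"
      by (subst step[OF sets.top B]) (simp add: space_PiM emeasure_space_1 restrict_def)
    finally show "emeasure (distr ?L M (\<lambda>\<omega>. \<omega> 0)) B = emeasure \<mu> B" .
  qed (simp add: mu')
qed

definition residual ::
    "('a \<Rightarrow> 'a measure) \<Rightarrow> real \<Rightarrow> 'a measure \<Rightarrow> 'a \<Rightarrow> 'a measure" where
  "residual P \<epsilon> \<nu> x =
     (if \<epsilon> = 1 then null_measure (P x)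
      else scale_measure (ennreal (1 / (1 - \<epsilon>)))
             (diff_measure (P x) (scale_measure (ennreal \<epsilon>) \<nu>)))"

text \<open>
  The level \<open>\<delta>\<close> is encoded by \<open>bool\<close>, with \<open>True\<close> for 1. The factor
  \<open>\<epsilon> \<delta> + (1 - \<epsilon>) (1 - \<delta>)\<close> is the probability of \<open>\<delta>\<close> under the Bernoulli law with parameter
  \<open>\<epsilon>\<close>, so the kernel is a product measure; its values on rectangles are computed below.
\<close>

definition split_kernel ::
    "('a \<Rightarrow> 'a measure) \<Rightarrow> 'a set \<Rightarrow> real \<Rightarrow> 'a measure \<Rightarrow> 'a \<times> bool \<Rightarrow> ('a \<times> bool) measure" where
  "split_kernel P C \<epsilon> \<nu> = (\<lambda>(x, d).
     (if x \<notin> C then P x else if d then \<nu> else residual P \<epsilon> \<nu> x)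
       \<Otimes>\<^sub>M measure_pmf (bernoulli_pmf \<epsilon>))"

lemma sets_residual [simp]: "sets (residual P \<epsilon> \<nu> x) = sets (P x)"
  by (simp add: residual_def)

lemma emeasure_residual:
  assumes P: "P \<in> M \<rightarrow>\<^sub>M prob_algebra M" and \<nu>: "\<nu> \<in> space (prob_algebra M)"
    and x: "x \<in> space M" and A: "A \<in> sets M" and \<epsilon>: "0 < \<epsilon>" "\<epsilon> \<le> 1"
    and minor: "\<And>B. B \<in> sets M \<Longrightarrow> measure (P x) B \<ge> \<epsilon> * measure \<nu> B"
  shows "emeasure (residual P \<epsilon> \<nu> x) A =
           ennreal ((measure (P x) A - \<epsilon> * measure \<nu> A) / (1 - \<epsilon>))"
proof (cases "\<epsilon> = 1")
  case True
  then show ?thesis by (simp add: residual_def)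
next
  case False
  have "P x \<in> space (prob_algebra M)"
    using P x by (rule measurable_space)
  then have 1: "sets (P x) = sets M" "prob_space (P x)"
    by (auto simp: space_prob_algebra)
  have 2: "sets \<nu> = sets M" "prob_space \<nu>"
    using \<nu> by (auto simp: space_prob_algebra)
  interpret Px: prob_space "P x" by fact
  interpret N: prob_space \<nu> by fact
  have fin: "finite_measure (scale_measure (ennreal \<epsilon>) \<nu>)"
    by (rule finite_measureI) (simp add: space_scale_measure N.emeasure_space_1)
  have em: "emeasure (scale_measure (ennreal \<epsilon>) \<nu>) B = ennreal (\<epsilon> * measure \<nu> B)" for B
    using \<epsilon> by (simp add: N.emeasure_eq_measure ennreal_mult)
  have "emeasure (diff_measure (P x) (scale_measure (ennreal \<epsilon>) \<nu>)) A =
      emeasure (P x) A - emeasure (scale_measure (ennreal \<epsilon>) \<nu>) A"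
    using 1 2 A minor by (intro emeasure_diff_measure fin Px.finite_measure_axioms)
      (auto simp del: emeasure_scale_measure simp: em Px.emeasure_eq_measure intro!: ennreal_leI)
  also have "\<dots> = ennreal (measure (P x) A - \<epsilon> * measure \<nu> A)"
    using \<epsilon> by (simp del: emeasure_scale_measure add: em Px.emeasure_eq_measure ennreal_minus)
  finally show ?thesis
    using False \<epsilon> minor[OF A] by (simp add: residual_def ennreal_mult'[symmetric])
qed

lemma emeasure_split_kernel:
  fixes d e :: bool
  assumes P: "P \<in> M \<rightarrow>\<^sub>M prob_algebra M" and \<nu>: "\<nu> \<in> space (prob_algebra M)"
    and x: "x \<in> space M" and A: "A \<in> sets M" and \<epsilon>: "0 < \<epsilon>" "\<epsilon> \<le> 1"
  shows "emeasure (split_kernel P C \<epsilon> \<nu> (x, d)) (A \<times> {e}) =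
           ennreal (\<epsilon> * of_bool e + (1 - \<epsilon>) * (1 - of_bool e)) *
           (if x \<notin> C then emeasure (P x) A
            else if d then emeasure \<nu> A else emeasure (residual P \<epsilon> \<nu> x) A)"
proof -
  have "P x \<in> space (prob_algebra M)"
    using P x by (rule measurable_space)
  then have 1: "sets (P x) = sets M" by (auto simp: space_prob_algebra)
  have 2: "sets \<nu> = sets M" using \<nu> by (auto simp: space_prob_algebra)
  have "emeasure (measure_pmf (bernoulli_pmf \<epsilon>)) {e} =
      ennreal (\<epsilon> * of_bool e + (1 - \<epsilon>) * (1 - of_bool e))"
    using \<epsilon> by (cases e) (simp_all add: emeasure_pmf_single)
  then show ?thesis
    using 1 2 A by (auto simp: split_kernel_def measure_pmf.emeasure_pair_measure_Times mult.commute)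
qed

text \<open>
  \<open>start_in \<Omega> Z \<alpha>\<close> is the conditional probability measure given that \<open>Z 0 \<in> \<alpha>\<close>.
\<close>

definition start_in :: "'w measure \<Rightarrow> (nat \<Rightarrow> 'w \<Rightarrow> 's) \<Rightarrow> 's set \<Rightarrow> 'w measure" where
  "start_in \<Omega> Z \<alpha> = uniform_measure \<Omega> {\<omega>\<in>space \<Omega>. Z 0 \<omega> \<in> \<alpha>}"

text \<open>The value is \<open>\<infinity>\<close> (the infimum of the empty set) on paths that do not return.\<close>

definition return_time :: "(nat \<Rightarrow> 'w \<Rightarrow> 's) \<Rightarrow> 's set \<Rightarrow> 'w \<Rightarrow> enat" where
  "return_time Z \<alpha> \<omega> = (INF n\<in>{n. 1 \<le> n \<and> Z n \<omega> \<in> \<alpha>}. enat n)"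

definition mean_return_time :: "'w measure \<Rightarrow> (nat \<Rightarrow> 'w \<Rightarrow> 's) \<Rightarrow> 's set \<Rightarrow> ennreal" where
  "mean_return_time \<Omega> Z \<alpha> = (\<integral>\<^sup>+\<omega>. ennreal_of_enat (return_time Z \<alpha> \<omega>) \<partial>start_in \<Omega> Z \<alpha>)"

text \<open>
  \<open>tail_weight\<close> and \<open>tail_law\<close> are the \<open>p\<^sub>t\<close> and \<open>Q\<^sub>t\<close> of the mixture. An infinite mean return
  time would make all the weights 0; conditioning on an event of probability 0 gives 0.
\<close>

definition tail_weight :: "'w measure \<Rightarrow> (nat \<Rightarrow> 'w \<Rightarrow> 's) \<Rightarrow> 's set \<Rightarrow> nat \<Rightarrow> real" where
  "tail_weight \<Omega> Z \<alpha> t =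
     \<P>(\<omega> in start_in \<Omega> Z \<alpha>. enat t \<le> return_time Z \<alpha> \<omega>) / enn2real (mean_return_time \<Omega> Z \<alpha>)"

definition tail_law ::
    "'w measure \<Rightarrow> (nat \<Rightarrow> 'w \<Rightarrow> 'a \<times> bool) \<Rightarrow> ('a \<times> bool) set \<Rightarrow> nat \<Rightarrow> 'a set \<Rightarrow> real" where
  "tail_law \<Omega> Z \<alpha> t A =
     \<P>(\<omega> in start_in \<Omega> Z \<alpha>. fst (Z t \<omega>) \<in> A \<bar> enat t \<le> return_time Z \<alpha> \<omega>)"

end

theory Submission
  imports Defs
begin

text \<open>
  Started at \<open>\<alpha>\<close>, the split chain has \<open>X\<^sub>1 \<sim> \<nu>\<close>, and on \<open>\<tau>\<^sub>\<alpha> \<ge> t\<close> the coin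
  \<open>\<delta>\<^sub>t\<close> is independent of \<open>X\<^sub>t\<close>; averaging it out shows that \<open>\<mu>\<^sub>t = Pr\<^sub>\<alpha> (X\<^sub>t \<in> \<cdot>, \<tau>\<^sub>\<alpha> \<ge> t)\<close> equals
  \<open>\<nu> T\<^sup>t\<^sup>-\<^sup>1\<close> for the taboo kernel \<open>T(x, \<cdot>) = P(x, \<cdot>) - \<epsilon> 1\<^sub>C(x) \<nu>\<close>.
  Invariance reads \<open>\<pi> = c \<nu> + \<pi> T\<close> with \<open>c = \<epsilon> \<pi>(C)\<close>; iterating gives
  \<open>c G \<le> \<pi>\<close> for \<open>G = \<Sum>\<^sub>t \<mu>\<^sub>t\<close>, so \<open>G\<close> is finite. Since
  \<open>G P = G - \<nu> + \<epsilon> G(C) \<nu>\<close> and \<open>P\<close> preserves mass, \<open>\<epsilon> G(C) = 1\<close> and \<open>G\<close> is invariant.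
  Then \<open>\<pi> - c G\<close> is an invariant measure that does not charge \<open>C\<close>; it vanishes because
  irreducibility lets the chain reach \<open>C\<close> from every point. Finally \<open>E\<^sub>\<alpha> \<tau>\<^sub>\<alpha> = G(X) = 1 / c\<close>.
\<close>

section \<open>Integration against sums of measures\<close>

text \<open>Both sides respect each stage in the construction of a nonnegative measurable function.
  At an increasing limit the supremum passes through the series, because for every \<open>n\<close>
  the integrals increase with \<open>i\<close>.\<close>

lemma nn_integral_suminf_measure:
  assumes sets: "sets N = sets M" "\<And>n::nat. sets (K n) = sets M"
    and sum: "\<And>A. A \<in> sets M \<Longrightarrow> emeasure N A = (\<Sum>n. emeasure (K n) A)"
    and f: "f \<in> borel_measurable M"
  shows "(\<integral>\<^sup>+x. f x \<partial>N) = (\<Sum>n. \<integral>\<^sup>+x. f x \<partial>K n)"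
  using f
proof (induction rule: borel_measurable_induct)
  case (cong f g)
  have "(\<integral>\<^sup>+x. f x \<partial>L) = (\<integral>\<^sup>+x. g x \<partial>L)" if "sets L = sets M" for L
    using cong(3) sets_eq_imp_space_eq[OF that] by (intro nn_integral_cong) simp
  then show ?case using cong sets by simp
next
  case (set A)
  then show ?case using sum sets by simp
next
  case (mult u c)
  then show ?case using sets by (simp add: nn_integral_cmult cong: measurable_cong_sets)
next
  case (add u v)
  then show ?case using sets by (simp add: nn_integral_add suminf_add cong: measurable_cong_sets)
next
  case (seq U)
  have [measurable]: "U i \<in> borel_measurable L" if "sets L = sets M" for L i
    using seq(1)[of i] that by (simp cong: measurable_cong_sets)
  have mono: "incseq (\<lambda>i. integral\<^sup>N (K n) (U i))" for n
    using seq(3) by (auto simp: incseq_def le_fun_def intro!: nn_integral_mono)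
  have "(\<integral>\<^sup>+x. (SUP i. U i x) \<partial>N) = (SUP i. \<Sum>n. integral\<^sup>N (K n) (U i))"
    using seq sets by (subst nn_integral_monotone_convergence_SUP) auto
  also have "\<dots> = (\<Sum>n. SUP i. integral\<^sup>N (K n) (U i))"
    using mono by (intro ennreal_suminf_SUP_eq[symmetric])
  also have "\<dots> = (\<Sum>n. \<integral>\<^sup>+x. (SUP i. U i x) \<partial>K n)"
    using seq sets by (subst nn_integral_monotone_convergence_SUP) auto
  finally show ?case by (simp add: image_comp)
qed

lemma nn_integral_add_measure:
  assumes sets: "sets N = sets M" "sets K = sets M" "sets L = sets M"
    and sum: "\<And>A. A \<in> sets M \<Longrightarrow> emeasure N A = emeasure K A + emeasure L A"
    and f: "f \<in> borel_measurable M"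
  shows "(\<integral>\<^sup>+x. f x \<partial>N) = (\<integral>\<^sup>+x. f x \<partial>K) + (\<integral>\<^sup>+x. f x \<partial>L)"
proof -
  \<comment> \<open>Padding with null measures turns the two summands into a series.\<close>
  define S where "S n = (if n = 0 then K else if n = 1 then L else null_measure M)" for n :: nat
  have two: "(\<Sum>n. g n) = g 0 + g 1" if "\<And>n. n \<ge> 2 \<Longrightarrow> g n = 0" for g :: "nat \<Rightarrow> ennreal"
    using suminf_finite[of "{0, 1}" g] that by (force simp: not_le)
  have "(\<integral>\<^sup>+x. f x \<partial>N) = (\<Sum>n. \<integral>\<^sup>+x. f x \<partial>S n)"
  proof (rule nn_integral_suminf_measure[OF sets(1) _ _ f])
    show "sets (S n) = sets M" for n using sets by (simp add: S_def)
    show "emeasure N A = (\<Sum>n. emeasure (S n) A)" if "A \<in> sets M" for A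
      using sum[OF that] by (subst two) (auto simp: S_def)
  qed
  also have "\<dots> = (\<integral>\<^sup>+x. f x \<partial>K) + (\<integral>\<^sup>+x. f x \<partial>L)"
    by (subst two) (auto simp: S_def)
  finally show ?thesis .
qed

text \<open>Countable additivity is Tonelli's theorem for a double series, the sum over
  \<open>n\<close> being read as an integral against counting measure.\<close>

lemma ex_suminf_measure:
  fixes K :: "nat \<Rightarrow> 'a measure"
  assumes "\<And>n. sets (K n) = sets M"
  obtains N where "sets N = sets M" "\<And>A. A \<in> sets M \<Longrightarrow> emeasure N A = (\<Sum>n. emeasure (K n) A)"
proof
  let ?e = "\<lambda>A. \<Sum>n. emeasure (K n) A"
  let ?N = "measure_of (space M) (sets M) ?e"
  show sets: "sets ?N = sets M" by simp
  show "emeasure ?N A = ?e A" if "A \<in> sets M" for A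
  proof (rule emeasure_measure_of[OF refl])
    show "countably_additive (sets ?N) ?e"
    proof (rule countably_additiveI)
      fix F :: "nat \<Rightarrow> 'a set"
      assume F: "range F \<subseteq> sets ?N" "disjoint_family F"
      have "(\<Sum>i. ?e (F i)) = (\<Sum>i. \<integral>\<^sup>+n. emeasure (K n) (F i) \<partial>count_space UNIV)"
        by (simp add: nn_integral_count_space_nat)
      also have "\<dots> = (\<integral>\<^sup>+n. (\<Sum>i. emeasure (K n) (F i)) \<partial>count_space UNIV)"
        by (rule nn_integral_suminf[symmetric]) simp
      also have "\<dots> = ?e (\<Union> (range F))"
        using F assms by (simp add: suminf_emeasure nn_integral_count_space_nat)
      finally show "(\<Sum>i. ?e (F i)) = ?e (\<Union> (range F))" .
    qed
  qed (use that sets.space_closed in \<open>auto simp: positive_def\<close>)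
qed

section \<open>One-step laws and visits to a set\<close>

text \<open>Taking the whole space of histories as the past event leaves a relation between the laws
  of \<open>Z n\<close> and \<open>Z (Suc n)\<close> alone; integrals of \<open>g\<close> then
  follow through the bind.\<close>

lemma markov_chain_step:
  assumes chain: "markov_chain \<Omega> Z M K" and K: "K \<in> M \<rightarrow>\<^sub>M subprob_algebra M"
    and g: "g \<in> borel_measurable M"
  shows "(\<integral>\<^sup>+\<omega>. g (Z (Suc n) \<omega>) \<partial>\<Omega>) = (\<integral>\<^sup>+\<omega>. (\<integral>\<^sup>+y. g y \<partial>K (Z n \<omega>)) \<partial>\<Omega>)"
proof -
  interpret prob_space \<Omega> using chain by (simp add: markov_chain_def)
  have Z [measurable]: "Z n \<in> \<Omega> \<rightarrow>\<^sub>M M" for n using chain by (simp add: markov_chain_def)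
  have ne: "space M \<noteq> {}" using not_empty measurable_space[OF Z] by auto
  have "distr \<Omega> M (Z (Suc n)) = distr \<Omega> M (Z n) \<bind> K"
  proof (rule measure_eqI)
    show "sets (distr \<Omega> M (Z (Suc n))) = sets (distr \<Omega> M (Z n) \<bind> K)"
      using ne K by (subst sets_bind[where N = M]) (auto dest: sets_kernel)
    fix B assume "B \<in> sets (distr \<Omega> M (Z (Suc n)))"
    then have B [measurable]: "B \<in> sets M" by simp
    have KB: "(\<lambda>x. emeasure (K x) B) \<in> borel_measurable M"
      using K B by (rule measurable_emeasure_kernel)
    have *: "(\<lambda>i\<in>{..n}. Z i \<omega>) \<in> space (Pi\<^sub>M {..n} (\<lambda>_. M))" if "\<omega> \<in> space \<Omega>" for \<omega>
      using measurable_space[OF Z that] by (simp add: space_PiM PiE_iff)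
    have "emeasure (distr \<Omega> M (Z (Suc n))) B =
        emeasure \<Omega> {\<omega>\<in>space \<Omega>. (\<lambda>i\<in>{..n}. Z i \<omega>) \<in> space (Pi\<^sub>M {..n} (\<lambda>_. M)) \<and> Z (Suc n) \<omega> \<in> B}"
      using * by (auto simp: emeasure_distr intro!: arg_cong[where f = "emeasure \<Omega>"])
    also have "\<dots> = (\<integral>\<^sup>+\<omega>. indicator (space (Pi\<^sub>M {..n} (\<lambda>_. M))) (\<lambda>i\<in>{..n}. Z i \<omega>) *
        emeasure (K (Z n \<omega>)) B \<partial>\<Omega>)"
      using chain B unfolding markov_chain_def by blast
    also have "\<dots> = (\<integral>\<^sup>+\<omega>. emeasure (K (Z n \<omega>)) B \<partial>\<Omega>)"
      by (intro nn_integral_cong) (simp add: *)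
    also have "\<dots> = emeasure (distr \<Omega> M (Z n) \<bind> K) B"
      using ne K KB by (subst emeasure_bind[where N = M]) (auto simp: nn_integral_distr)
    finally show "emeasure (distr \<Omega> M (Z (Suc n))) B = emeasure (distr \<Omega> M (Z n) \<bind> K) B" .
  qed
  then have "(\<integral>\<^sup>+y. g y \<partial>distr \<Omega> M (Z (Suc n))) = (\<integral>\<^sup>+y. g y \<partial>(distr \<Omega> M (Z n) \<bind> K))" by simp
  moreover have "(\<lambda>x. \<integral>\<^sup>+y. g y \<partial>K x) \<in> borel_measurable M"
    using measurable_compose[OF K nn_integral_measurable_subprob_algebra[OF g]] .
  ultimately show ?thesis
    using K g by (simp add: nn_integral_bind[where B = M] nn_integral_distr)
qed

text \<open>This is P^k(x, C), the probability of being in \<open>C\<close> at time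
  \<open>k\<close>; earlier visits are not excluded.\<close>

primrec hit_prob :: "('a \<Rightarrow> 'a measure) \<Rightarrow> 'a set \<Rightarrow> nat \<Rightarrow> 'a \<Rightarrow> ennreal" where
  "hit_prob P C 0 = indicator C"
| "hit_prob P C (Suc k) = (\<lambda>x. \<integral>\<^sup>+y. hit_prob P C k y \<partial>P x)"

lemma measurable_hit_prob:
  assumes "P \<in> M \<rightarrow>\<^sub>M subprob_algebra M" "C \<in> sets M"
  shows "hit_prob P C k \<in> borel_measurable M"
proof (induction k)
  case 0
  show ?case using assms(2) by (simp only: hit_prob.simps borel_measurable_indicator)
next
  case (Suc k)
  show ?case
    using measurable_compose[OF assms(1) nn_integral_measurable_subprob_algebra[OF Suc]]
    by (simp only: hit_prob.simps)
qed

text \<open>If P^k(x, C) = 0 for every k, the chain from \<open>x\<close> is almost surely outside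
  \<open>C\<close> at each time, hence at all times at once by countability, against
  irreducibility.\<close>

lemma irreducible_chain_hit_prob:
  assumes P: "P \<in> M \<rightarrow>\<^sub>M prob_algebra M" and irr: "irreducible_chain M P \<psi>"
    and C: "C \<in> sets M" "emeasure \<psi> C > 0" and x: "x \<in> space M"
  shows "\<exists>k. hit_prob P C k x \<noteq> 0"
proof (rule ccontr)
  assume zero: "\<not> ?thesis"
  let ?L = "path_law M P (return M x)"
  have P': "P \<in> M \<rightarrow>\<^sub>M subprob_algebra M" using P by (rule measurable_prob_algebraD)
  have ret: "return M x \<in> space (prob_algebra M)"
    using x by (simp add: space_prob_algebra prob_space_return)
  note chain = markov_chain_path_law[OF P ret]
  have coord [measurable]: "(\<lambda>\<omega>. \<omega> n) \<in> ?L \<rightarrow>\<^sub>M M" for n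
    using chain(1) by (simp add: markov_chain_def)
  note meas = measurable_hit_prob[OF P' C(1)]
  \<comment> \<open>One step back in time trades a unit of \<open>n\<close> for a unit of
    \<open>k\<close>, which is why \<open>k\<close> varies in the induction.\<close>
  have int: "(\<integral>\<^sup>+\<omega>. hit_prob P C k (\<omega> n) \<partial>?L) = hit_prob P C (k + n) x" for k n
  proof (induction n arbitrary: k)
    case 0
    have "(\<integral>\<^sup>+\<omega>. hit_prob P C k (\<omega> 0) \<partial>?L) =
        (\<integral>\<^sup>+y. hit_prob P C k y \<partial>distr ?L M (\<lambda>\<omega>. \<omega> 0))"
      by (rule nn_integral_distr[OF coord, symmetric]) (simp add: meas)
    also have "\<dots> = (\<integral>\<^sup>+y. hit_prob P C k y \<partial>return M x)" by (simp only: chain(2))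
    finally have "(\<integral>\<^sup>+\<omega>. hit_prob P C k (\<omega> 0) \<partial>?L) = (\<integral>\<^sup>+y. hit_prob P C k y \<partial>return M x)" .
    then show ?case using x meas by (simp add: nn_integral_return)
  next
    case (Suc n)
    then show ?case
      using markov_chain_step[OF chain(1) P' meas[of k], of n] Suc[of "Suc k"] by simp
  qed
  have int0: "(\<integral>\<^sup>+\<omega>. indicator C (\<omega> n) \<partial>?L) = 0" for n
    using zero int[of 0 n] by simp
  have "AE \<omega> in ?L. \<omega> n \<notin> C" for n
  proof -
    have "(indicator C :: _ \<Rightarrow> ennreal) \<in> borel_measurable M" using C(1) by simp
    from nn_integral_0_iff_AE[OF measurable_compose[OF coord this]] int0[of n]
    have "AE \<omega> in ?L. indicator C (\<omega> n) = (0 :: ennreal)" by blast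
    then show ?thesis by eventually_elim (simp add: indicator_eq_0_iff)
  qed
  then have "AE \<omega> in ?L. \<forall>n. \<omega> n \<notin> C" by (simp add: AE_all_countable)
  then have "AE \<omega> in ?L. \<not> (\<exists>n\<ge>1. \<omega> n \<in> C)" by eventually_elim blast
  moreover have "{\<omega>\<in>space ?L. \<exists>n\<ge>1. \<omega> n \<in> C} \<in> sets ?L"
  proof -
    have "{\<omega>\<in>space ?L. \<exists>n\<ge>1. \<omega> n \<in> C} = (\<Union>n\<in>{1..}. (\<lambda>\<omega>. \<omega> n) -` C \<inter> space ?L)" by blast
    then show ?thesis using measurable_sets[OF coord C(1)] by (simp only:) blast
  qed
  ultimately have "emeasure ?L {\<omega>\<in>space ?L. \<exists>n\<ge>1. \<omega> n \<in> C} = 0"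
    by (subst (asm) AE_iff_measurable) (simp_all only: not_not)
  then have "\<P>(\<omega> in ?L. \<exists>n\<ge>1. \<omega> n \<in> C) = 0" by (simp add: measure_def)
  moreover have "\<P>(\<omega> in ?L. \<exists>n\<ge>1. \<omega> n \<in> C) > 0"
    using irr C x unfolding irreducible_chain_def by blast
  ultimately show False by (simp only: less_irrefl)
qed

section \<open>The taboo kernel of a minorized kernel\<close>

locale minorized_kernel =
  fixes M :: "'a measure" and P :: "'a \<Rightarrow> 'a measure" and C :: "'a set" and \<epsilon> :: real
    and \<nu> :: "'a measure"
  assumes P: "P \<in> M \<rightarrow>\<^sub>M prob_algebra M" and C [measurable]: "C \<in> sets M"
    and eps: "0 < \<epsilon>" "\<epsilon> \<le> 1" and nu: "\<nu> \<in> space (prob_algebra M)"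
    and minor: "\<And>x A. x \<in> C \<Longrightarrow> A \<in> sets M \<Longrightarrow> measure (P x) A \<ge> \<epsilon> * measure \<nu> A"
begin

text \<open>On \<open>C\<close> this is (1 - \<epsilon>) R, written without a division so that
  \<epsilon> = 1 is no special case; off \<open>C\<close> the indicator makes the subtracted measure
  zero.\<close>

definition taboo_kernel :: "'a \<Rightarrow> 'a measure" where
  "taboo_kernel x = diff_measure (P x) (scale_measure (ennreal \<epsilon> * indicator C x) \<nu>)"

text \<open>\<open>taboo_law n\<close> is the law at time \<open>n + 1\<close>: the index counts from the first step after \<open>\<alpha>\<close>.\<close>

primrec taboo_law :: "nat \<Rightarrow> 'a measure" where
  "taboo_law 0 = \<nu>"
| "taboo_law (Suc n) = taboo_law n \<bind> taboo_kernel"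

lemma P_subprob [measurable]: "P \<in> M \<rightarrow>\<^sub>M subprob_algebra M"
  using P by (rule measurable_prob_algebraD)

lemma prob_P: "x \<in> space M \<Longrightarrow> prob_space (P x)"
  and sets_P: "x \<in> space M \<Longrightarrow> sets (P x) = sets M"
  using measurable_space[OF P] by (auto simp: space_prob_algebra)

lemma prob_nu: "prob_space \<nu>" and sets_nu [simp]: "sets \<nu> = sets M"
  using nu by (auto simp: space_prob_algebra)

lemma space_P: "x \<in> space M \<Longrightarrow> space (P x) = space M"
  using sets_P sets_eq_imp_space_eq by blast

lemma space_nu [simp]: "space \<nu> = space M"
  using sets_nu sets_eq_imp_space_eq by blast

lemma space_not_empty: "space M \<noteq> {}"
  using prob_space.not_empty[OF prob_nu] by simp

lemma emeasure_minor:
  assumes x: "x \<in> space M" and A: "A \<in> sets M"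
  shows "ennreal \<epsilon> * indicator C x * emeasure \<nu> A \<le> emeasure (P x) A"
proof -
  interpret Px: prob_space "P x" using x by (rule prob_P)
  interpret N: prob_space \<nu> by (rule prob_nu)
  show ?thesis
    using minor[OF _ A] eps
    by (auto simp: Px.emeasure_eq_measure N.emeasure_eq_measure ennreal_mult[symmetric]
        split: split_indicator intro!: ennreal_leI)
qed

lemma sets_taboo_kernel: "x \<in> space M \<Longrightarrow> sets (taboo_kernel x) = sets M"
  by (simp add: taboo_kernel_def sets_P)

lemma emeasure_taboo_kernel:
  assumes x: "x \<in> space M" and A: "A \<in> sets M"
  shows "emeasure (taboo_kernel x) A = emeasure (P x) A - ennreal \<epsilon> * indicator C x * emeasure \<nu> A"
proof -
  interpret Px: prob_space "P x" using x by (rule prob_P)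
  interpret N: prob_space \<nu> by (rule prob_nu)
  have "finite_measure (scale_measure (ennreal \<epsilon> * indicator C x) \<nu>)"
    by (rule finite_measureI)
      (simp add: space_scale_measure N.emeasure_space_1[simplified] ennreal_mult_eq_top_iff split: split_indicator)
  then show ?thesis
    unfolding taboo_kernel_def using x A emeasure_minor
    by (subst emeasure_diff_measure) (auto simp: sets_P intro: Px.finite_measure_axioms)
qed

text \<open>The minorization ensures that nothing is lost in the truncated subtraction of
  \<open>ennreal\<close>. The additive form is the one that can be integrated.\<close>

lemma emeasure_P_taboo:
  assumes x: "x \<in> space M" and A: "A \<in> sets M"
  shows "emeasure (P x) A = emeasure (taboo_kernel x) A + ennreal \<epsilon> * indicator C x * emeasure \<nu> A"
  using emeasure_minor[OF x A] x A by (simp add: emeasure_taboo_kernel diff_add_cancel_ennreal)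

lemma measurable_taboo_kernel [measurable]: "taboo_kernel \<in> M \<rightarrow>\<^sub>M subprob_algebra M"
proof (rule measurable_subprob_algebra)
  fix x assume x: "x \<in> space M"
  then show sets: "sets (taboo_kernel x) = sets M" by (rule sets_taboo_kernel)
  interpret Px: prob_space "P x" using x by (rule prob_P)
  have "emeasure (taboo_kernel x) (space M) \<le> emeasure (P x) (space M)"
    using x by (simp add: emeasure_P_taboo)
  also have "\<dots> = 1" using Px.emeasure_space_1 x by (simp add: space_P)
  finally show "subprob_space (taboo_kernel x)"
    using sets_eq_imp_space_eq[OF sets] space_not_empty by (intro subprob_spaceI) auto
next
  fix A assume A [measurable]: "A \<in> sets M"
  have "(\<lambda>x. emeasure (P x) A - ennreal \<epsilon> * indicator C x * emeasure \<nu> A) \<in> borel_measurable M"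
    using measurable_emeasure_kernel[OF P_subprob A] by measurable
  then show "(\<lambda>x. emeasure (taboo_kernel x) A) \<in> borel_measurable M"
    by (rule measurable_cong[THEN iffD1, rotated]) (simp add: emeasure_taboo_kernel A)
qed

lemma nn_integral_P_taboo:
  assumes x: "x \<in> space M" and g: "g \<in> borel_measurable M"
  shows "(\<integral>\<^sup>+y. g y \<partial>P x) =
    (\<integral>\<^sup>+y. g y \<partial>taboo_kernel x) + ennreal \<epsilon> * indicator C x * (\<integral>\<^sup>+y. g y \<partial>\<nu>)"
proof -
  have "(\<integral>\<^sup>+y. g y \<partial>P x) = (\<integral>\<^sup>+y. g y \<partial>taboo_kernel x) +
      (\<integral>\<^sup>+y. g y \<partial>scale_measure (ennreal \<epsilon> * indicator C x) \<nu>)"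
    using x g by (intro nn_integral_add_measure) (auto simp: sets_P sets_taboo_kernel emeasure_P_taboo)
  then show ?thesis using g by (simp add: nn_integral_scale_measure cong: measurable_cong_sets)
qed

lemma measurable_kernel_integral:
  assumes g: "g \<in> borel_measurable M"
  shows "(\<lambda>x. \<integral>\<^sup>+y. g y \<partial>taboo_kernel x) \<in> borel_measurable M"
    and "(\<lambda>x. \<integral>\<^sup>+y. g y \<partial>P x) \<in> borel_measurable M"
  using measurable_compose[OF measurable_taboo_kernel nn_integral_measurable_subprob_algebra[OF g]]
    measurable_compose[OF P_subprob nn_integral_measurable_subprob_algebra[OF g]] by simp_all

text \<open>A step out of \<open>m\<close> either follows the taboo kernel or regenerates from
  \<nu>, the latter with mass \<epsilon> m(C). The measure \<open>m\<close> is arbitrary because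
  both \<pi> and the sum G of the taboo laws are put in its place.\<close>

lemma flow_taboo:
  assumes m: "sets m = sets M" and g: "g \<in> borel_measurable M"
  shows "(\<integral>\<^sup>+x. \<integral>\<^sup>+y. g y \<partial>P x \<partial>m) =
    (\<integral>\<^sup>+x. \<integral>\<^sup>+y. g y \<partial>taboo_kernel x \<partial>m) + ennreal \<epsilon> * emeasure m C * (\<integral>\<^sup>+y. g y \<partial>\<nu>)"
proof -
  have sp: "space m = space M" using m by (rule sets_eq_imp_space_eq)
  note [measurable_cong] = m
  note [measurable] = measurable_kernel_integral(1)[OF g]
  have "(\<integral>\<^sup>+x. \<integral>\<^sup>+y. g y \<partial>P x \<partial>m) = (\<integral>\<^sup>+x. (\<integral>\<^sup>+y. g y \<partial>taboo_kernel x) +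
      ennreal \<epsilon> * indicator C x * (\<integral>\<^sup>+y. g y \<partial>\<nu>) \<partial>m)"
    using g by (intro nn_integral_cong nn_integral_P_taboo) (simp_all add: sp)
  also have "\<dots> = (\<integral>\<^sup>+x. \<integral>\<^sup>+y. g y \<partial>taboo_kernel x \<partial>m) +
      (\<integral>\<^sup>+x. ennreal \<epsilon> * indicator C x * (\<integral>\<^sup>+y. g y \<partial>\<nu>) \<partial>m)"
    by (rule nn_integral_add) measurable
  also have "(\<integral>\<^sup>+x. ennreal \<epsilon> * indicator C x * (\<integral>\<^sup>+y. g y \<partial>\<nu>) \<partial>m) =
      (\<integral>\<^sup>+x. (ennreal \<epsilon> * (\<integral>\<^sup>+y. g y \<partial>\<nu>)) * indicator C x \<partial>m)"
    by (simp add: ac_simps)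
  also have "\<dots> = ennreal \<epsilon> * emeasure m C * (\<integral>\<^sup>+y. g y \<partial>\<nu>)"
    using m by (subst nn_integral_cmult_indicator) (auto simp: ac_simps)
  finally show ?thesis .
qed

lemma sets_taboo_law [simp]: "sets (taboo_law n) = sets M"
  and space_taboo_law [simp]: "space (taboo_law n) = space M"
proof -
  show *: "sets (taboo_law n) = sets M" for n
  proof (induction n)
    case (Suc n)
    then have "space (taboo_law n) = space M" by (rule sets_eq_imp_space_eq)
    then show ?case
      using space_not_empty unfolding taboo_law.simps
      by (intro sets_bind[where N = M]) (simp_all add: sets_taboo_kernel)
  qed simp
  then show "space (taboo_law n) = space M" using sets_eq_imp_space_eq by blast
qed

lemma nn_integral_taboo_law_Suc:
  assumes g: "g \<in> borel_measurable M"
  shows "(\<integral>\<^sup>+x. g x \<partial>taboo_law (Suc n)) = (\<integral>\<^sup>+x. \<integral>\<^sup>+y. g y \<partial>taboo_kernel x \<partial>taboo_law n)"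
proof -
  have "taboo_kernel \<in> taboo_law n \<rightarrow>\<^sub>M subprob_algebra M"
    using measurable_taboo_kernel by (simp cong: measurable_cong_sets)
  then show ?thesis using g by (simp add: nn_integral_bind[where B = M])
qed

section \<open>The invariant probability as a sum of taboo laws\<close>

text \<open>With c = \<epsilon> \<pi>(C), iterating \<pi> = c \<nu> + \<pi> T gives \<pi> = c (\<nu>
  + ... + \<nu> T^(n-1)) + \<pi> T^n, and the last term is nonnegative. The function
  \<open>g\<close> varies in the induction because each step moves T onto it.\<close>

lemma taboo_law_sum_le_invariant:
  assumes inv: "invariant_prob M P \<pi>" and g: "g \<in> borel_measurable M"
  shows "ennreal \<epsilon> * emeasure \<pi> C * (\<Sum>k<n. \<integral>\<^sup>+x. g x \<partial>taboo_law k) \<le> (\<integral>\<^sup>+x. g x \<partial>\<pi>)"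
  using g
proof (induction n arbitrary: g)
  case (Suc n)
  let ?c = "ennreal \<epsilon> * emeasure \<pi> C" and ?T = "\<lambda>x. \<integral>\<^sup>+y. g y \<partial>taboo_kernel x"
  have sets: "sets \<pi> = sets M" using inv by (simp add: invariant_prob_def space_prob_algebra)
  have "P \<in> \<pi> \<rightarrow>\<^sub>M subprob_algebra M"
    using P_subprob sets by (simp cong: measurable_cong_sets)
  then have "(\<integral>\<^sup>+x. g x \<partial>\<pi>) = (\<integral>\<^sup>+x. \<integral>\<^sup>+y. g y \<partial>P x \<partial>\<pi>)"
    using inv Suc.prems nn_integral_bind[of g M P \<pi>] by (simp add: invariant_prob_def)
  also have "\<dots> = (\<integral>\<^sup>+x. ?T x \<partial>\<pi>) + ?c * (\<integral>\<^sup>+y. g y \<partial>\<nu>)"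
    by (rule flow_taboo[OF sets Suc.prems])
  finally have *: "(\<integral>\<^sup>+x. g x \<partial>\<pi>) = (\<integral>\<^sup>+x. ?T x \<partial>\<pi>) + ?c * (\<integral>\<^sup>+y. g y \<partial>\<nu>)" .
  have "?c * (\<Sum>k<Suc n. \<integral>\<^sup>+x. g x \<partial>taboo_law k) =
      ?c * (\<Sum>k<n. \<integral>\<^sup>+x. ?T x \<partial>taboo_law k) + ?c * (\<integral>\<^sup>+y. g y \<partial>\<nu>)"
    unfolding sum.lessThan_Suc_shift nn_integral_taboo_law_Suc[OF Suc.prems]
    by (simp add: distrib_left add.commute)
  also have "\<dots> \<le> (\<integral>\<^sup>+x. g x \<partial>\<pi>)"
    unfolding * by (intro add_right_mono Suc.IH measurable_kernel_integral Suc.prems)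
  finally show ?case .
qed simp

lemma invariant_eq_suminf_taboo_law:
  assumes inv: "invariant_prob M P \<pi>" and irr: "irreducible_chain M P \<pi>"
    and posC: "emeasure \<pi> C > 0" and A: "A \<in> sets M"
  shows "emeasure \<pi> A = ennreal \<epsilon> * emeasure \<pi> C * (\<Sum>n. emeasure (taboo_law n) A)"
proof -
  let ?c = "ennreal \<epsilon> * emeasure \<pi> C"
  have \<pi>: "prob_space \<pi>" and sets_\<pi> [simp]: "sets \<pi> = sets M" and bind_\<pi>: "\<pi> \<bind> P = \<pi>"
    using inv by (auto simp: invariant_prob_def space_prob_algebra)
  interpret \<pi>: prob_space \<pi> by (rule \<pi>)
  have space_\<pi> [simp]: "space \<pi> = space M" using sets_\<pi> by (rule sets_eq_imp_space_eq)
  have c0: "?c \<noteq> 0" using posC eps by auto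
  \<comment> \<open>Once the taboo laws are identified with those of the split chain, G is the
    expected occupation measure of the times 1 to \<tau> of one cycle.\<close>
  obtain G where sets_G [simp]: "sets G = sets M"
    and G: "\<And>A. A \<in> sets M \<Longrightarrow> emeasure G A = (\<Sum>n. emeasure (taboo_law n) A)"
    using ex_suminf_measure[of taboo_law M] by auto
  have space_G [simp]: "space G = space M" using sets_G by (rule sets_eq_imp_space_eq)
  have int_G: "(\<integral>\<^sup>+x. g x \<partial>G) = (\<Sum>n. \<integral>\<^sup>+x. g x \<partial>taboo_law n)" if "g \<in> borel_measurable M" for g
    using that G by (intro nn_integral_suminf_measure[where M = M]) auto
  have dom: "?c * emeasure G B \<le> emeasure \<pi> B" if B: "B \<in> sets M" for B
  proof -
    have "?c * emeasure G B = (\<Sum>n. ?c * emeasure (taboo_law n) B)" using B by (simp add: G)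
    also have "\<dots> \<le> emeasure \<pi> B"
    proof (rule suminf_le_const[OF summableI])
      fix n show "(\<Sum>k<n. ?c * emeasure (taboo_law k) B) \<le> emeasure \<pi> B"
        using taboo_law_sum_le_invariant[OF inv, of "indicator B" n] B
        by (simp add: sum_distrib_left)
    qed
    finally show ?thesis .
  qed
  \<comment> \<open>As c is not 0, infinite mass of G would force infinite mass of \<pi>.\<close>
  have fin: "emeasure G (space M) \<noteq> \<infinity>"
    using dom[OF sets.top] c0 \<pi>.emeasure_space_1 by (auto simp: ennreal_mult_top top_unique)
  \<comment> \<open>Shifting the index gives G = \<nu> + G T, and \<open>flow_taboo\<close> gives G
    P = G T + \<epsilon> G(C) \<nu>. Eliminating G T with \<nu> on the left avoids
    subtraction.\<close>
  have flow_G: "(\<integral>\<^sup>+x. \<integral>\<^sup>+y. g y \<partial>P x \<partial>G) + (\<integral>\<^sup>+y. g y \<partial>\<nu>) =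
      (\<integral>\<^sup>+x. g x \<partial>G) + ennreal \<epsilon> * emeasure G C * (\<integral>\<^sup>+y. g y \<partial>\<nu>)"
    if g: "g \<in> borel_measurable M" for g
  proof -
    have "(\<integral>\<^sup>+x. g x \<partial>G) = (\<Sum>n. \<integral>\<^sup>+x. g x \<partial>taboo_law (Suc n)) + (\<integral>\<^sup>+y. g y \<partial>\<nu>)"
      unfolding int_G[OF g]
      using suminf_offset[of "\<lambda>n. \<integral>\<^sup>+x. g x \<partial>taboo_law n" 1] by (simp add: summableI add.commute)
    also have "(\<Sum>n. \<integral>\<^sup>+x. g x \<partial>taboo_law (Suc n)) = (\<integral>\<^sup>+x. \<integral>\<^sup>+y. g y \<partial>taboo_kernel x \<partial>G)"
      unfolding nn_integral_taboo_law_Suc[OF g] using measurable_kernel_integral[OF g] by (simp add: int_G)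
    finally show ?thesis using flow_taboo[OF sets_G g] by (simp add: ac_simps)
  qed
  \<comment> \<open>The balance is tested with the constant 1, whose integral \<open>P\<close>
    preserves; the finite mass of G then cancels.\<close>
  have GC: "ennreal \<epsilon> * emeasure G C = 1"
  proof -
    have "(\<integral>\<^sup>+x. \<integral>\<^sup>+y. 1 \<partial>P x \<partial>G) = (\<integral>\<^sup>+x. 1 \<partial>G)"
      using prob_space.emeasure_space_1[OF prob_P] by (intro nn_integral_cong) simp
    then have "emeasure G (space M) + ennreal \<epsilon> * emeasure G C = emeasure G (space M) + 1"
      using flow_G[of "\<lambda>_. 1"] prob_space.emeasure_space_1[OF prob_nu] by simp
    then show ?thesis using fin by (simp add: ennreal_add_left_cancel)
  qed
  have finD: "finite_measure (scale_measure ?c G)"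
    using fin by (intro finite_measureI)
      (simp add: space_scale_measure ennreal_mult_eq_top_iff)
  \<comment> \<open>The defect \<pi> - c G, a measure by \<open>dom\<close>; the aim is to show that
    it vanishes.\<close>
  define D where "D = diff_measure \<pi> (scale_measure ?c G)"
  have sets_D: "sets D = sets M" by (simp add: D_def)
  have space_D: "space D = space M" using sets_D by (rule sets_eq_imp_space_eq)
  have D: "emeasure \<pi> B = emeasure D B + emeasure (scale_measure ?c G) B" if "B \<in> sets M" for B
    unfolding D_def using that dom finD
    by (subst emeasure_diff_measure) (auto simp: diff_add_cancel_ennreal intro: \<pi>.finite_measure_axioms)
  have int_\<pi>: "(\<integral>\<^sup>+x. g x \<partial>\<pi>) = (\<integral>\<^sup>+x. g x \<partial>D) + ?c * (\<integral>\<^sup>+x. g x \<partial>G)"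
    if g: "g \<in> borel_measurable M" for g
  proof -
    have "(\<integral>\<^sup>+x. g x \<partial>\<pi>) = (\<integral>\<^sup>+x. g x \<partial>D) + (\<integral>\<^sup>+x. g x \<partial>scale_measure ?c G)"
      by (rule nn_integral_add_measure[OF sets_\<pi> sets_D _ D g]) simp_all
    then show ?thesis using g by (simp add: nn_integral_scale_measure cong: measurable_cong_sets)
  qed
  note meas = measurable_hit_prob[OF P_subprob C]
  have hit_\<pi>: "(\<integral>\<^sup>+x. hit_prob P C k x \<partial>\<pi>) = emeasure \<pi> C" for k
  proof (induction k)
    case (Suc k)
    have "P \<in> \<pi> \<rightarrow>\<^sub>M subprob_algebra M" using P_subprob by (simp cong: measurable_cong_sets)
    from nn_integral_bind[OF meas this] show ?case using Suc bind_\<pi> by simp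
  qed simp
  \<comment> \<open>Since \<epsilon> G(C) = 1, the \<nu>-integral occurs on both sides of the
    balance. It can be cancelled because it is the first term of the series for the G-integral,
    which is finite by induction.\<close>
  have hit_G: "(\<integral>\<^sup>+x. hit_prob P C k x \<partial>G) = emeasure G C" for k
  proof (induction k)
    case (Suc k)
    have "(\<integral>\<^sup>+y. hit_prob P C k y \<partial>\<nu>) \<le> (\<integral>\<^sup>+x. hit_prob P C k x \<partial>G)"
      using int_G[OF meas, of k] sum_le_suminf[of "\<lambda>n. \<integral>\<^sup>+x. hit_prob P C k x \<partial>taboo_law n" "{0}"]
      by (simp add: summableI)
    also have "\<dots> < \<infinity>"
      unfolding Suc using fin emeasure_mono[OF sets.sets_into_space[OF C], of G]
      by (auto simp: less_top[symmetric] top_unique)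
    finally have "(\<integral>\<^sup>+y. hit_prob P C k y \<partial>\<nu>) \<noteq> \<infinity>" by simp
    moreover have "(\<integral>\<^sup>+y. hit_prob P C k y \<partial>\<nu>) + (\<integral>\<^sup>+x. hit_prob P C (Suc k) x \<partial>G) =
        (\<integral>\<^sup>+y. hit_prob P C k y \<partial>\<nu>) + emeasure G C"
      using flow_G[OF meas, of k] unfolding GC Suc by (simp add: add.commute)
    ultimately show ?case unfolding ennreal_add_left_cancel by blast
  qed simp
  have "AE x in D. \<forall>k. hit_prob P C k x = 0"
    unfolding AE_all_countable
  proof
    fix k
    \<comment> \<open>Thus \<pi> and c G give P^k(x, C) the same finite integral, and nothing is
      left for \<open>D\<close>.\<close>
    have eq: "?c * emeasure G C = emeasure \<pi> C"
    proof -
      have "?c * emeasure G C = emeasure \<pi> C * (ennreal \<epsilon> * emeasure G C)"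
        by (simp only: ac_simps)
      then show ?thesis by (simp only: GC mult_1_right)
    qed
    have "emeasure \<pi> C + 0 = emeasure \<pi> C + (\<integral>\<^sup>+x. hit_prob P C k x \<partial>D)"
      using int_\<pi>[OF meas, of k] unfolding hit_\<pi> hit_G eq by (simp add: add.commute)
    then have "(\<integral>\<^sup>+x. hit_prob P C k x \<partial>D) = 0"
      unfolding ennreal_add_left_cancel by simp
    moreover have "hit_prob P C k \<in> borel_measurable D"
      using meas sets_D by (simp cong: measurable_cong_sets)
    ultimately show "AE x in D. hit_prob P C k x = 0" by (simp add: nn_integral_0_iff_AE)
  qed
  \<comment> \<open>By irreducibility every point has some k with P^k(x, C) > 0, so the exceptional
    null set of \<open>D\<close> is the whole space.\<close>
  then have "AE x in D. False"
    by (rule AE_mp) (use irreducible_chain_hit_prob[OF P irr C posC] space_D in auto)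
  then have "emeasure D (space D) = 0" using AE_iff_measurable[OF sets.top, of D "\<lambda>_. False"] by simp
  then have "emeasure D A = 0"
    using emeasure_mono[of A "space D" D] A sets.sets_into_space[OF A] space_D sets_D by simp
  then show ?thesis unfolding D[OF A] using A by (simp add: G)
qed


section \<open>Averaging the coin out of the split kernel\<close>

abbreviation coin_weight :: "bool \<Rightarrow> ennreal" where
  "coin_weight e \<equiv> ennreal (\<epsilon> * of_bool e + (1 - \<epsilon>) * (1 - of_bool e))"

lemma coin_weight_sum: "coin_weight True + coin_weight False = 1"
  using eps by (simp flip: ennreal_plus)

text \<open>
  The split kernel out of \<open>(x, d)\<close>, without the coin factor and killed on \<open>C \<times> {True}\<close>. For \<open>\<epsilon> = 1\<close>
  the quotient is 0, in accordance with \<open>residual\<close>.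
\<close>

definition killed_mass :: "'a set \<Rightarrow> bool \<Rightarrow> 'a \<Rightarrow> ennreal" where
  "killed_mass A d x =
     (if x \<notin> C then emeasure (P x) A else if d then 0
      else ennreal ((measure (P x) A - \<epsilon> * measure \<nu> A) / (1 - \<epsilon>)))"

lemma measurable_killed_mass:
  assumes A: "A \<in> sets M"
  shows "killed_mass A d \<in> borel_measurable M"
proof -
  have [measurable]: "(\<lambda>x. emeasure (P x) A) \<in> borel_measurable M"
    using P_subprob A by (rule measurable_emeasure_kernel)
  then have [measurable]: "(\<lambda>x. measure (P x) A) \<in> borel_measurable M"
    unfolding measure_def by measurable
  show ?thesis unfolding killed_mass_def[abs_def] by measurable
qed

lemma emeasure_split_kernel_outside:
  assumes x: "x \<in> space M" and A: "A \<in> sets M" and out: "(x, d) \<notin> C \<times> {True}"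
  shows "emeasure (split_kernel P C \<epsilon> \<nu> (x, d)) (A \<times> {e}) = coin_weight e * killed_mass A d x"
proof -
  have "emeasure (residual P \<epsilon> \<nu> x) A =
      ennreal ((measure (P x) A - \<epsilon> * measure \<nu> A) / (1 - \<epsilon>))" if "x \<in> C"
    using that by (intro emeasure_residual[OF P nu x A eps] minor)
  then show ?thesis
    unfolding emeasure_split_kernel[OF P nu x A eps] using out by (auto simp: killed_mass_def)
qed

lemma emeasure_split_kernel_atom:
  assumes x: "x \<in> space M" and A: "A \<in> sets M" and inside: "(x, d) \<in> C \<times> {True}"
  shows "emeasure (split_kernel P C \<epsilon> \<nu> (x, d)) (A \<times> {e}) = coin_weight e * emeasure \<nu> A"
  unfolding emeasure_split_kernel[OF P nu x A eps] using inside by auto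

text \<open>Off \<open>C\<close> both levels move by \<open>P\<close> and the coin weights add up to
  1. On \<open>C\<close> only the level \<open>False\<close> survives, and its weight 1 - \<epsilon>
  cancels the denominator of the residual measure.\<close>

lemma killed_mass_taboo_kernel:
  assumes x: "x \<in> space M" and A: "A \<in> sets M"
  shows "coin_weight True * killed_mass A True x + coin_weight False * killed_mass A False x =
    emeasure (taboo_kernel x) A"
proof (cases "x \<in> C")
  case False
  then show ?thesis
    using coin_weight_sum x A
    by (simp add: killed_mass_def emeasure_taboo_kernel flip: distrib_right)
next
  case True
  interpret Px: prob_space "P x" using x by (rule prob_P)
  interpret N: prob_space \<nu> by (rule prob_nu)
  let ?r = "measure (P x) A - \<epsilon> * measure \<nu> A"
  have r: "?r \<ge> 0" using minor[OF True A] by simp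
  have "(1 - \<epsilon>) * (?r / (1 - \<epsilon>)) = ?r"
  \<comment> \<open>For \<epsilon> = 1 the left side is 0, so \<open>?r\<close> has to vanish as
    well: the minorization of the complement of \<open>A\<close> yields the reverse inequality,
    whence \<open>P x\<close> and \<nu> agree on \<open>A\<close>.\<close>
  proof (cases "\<epsilon> = 1")
    case True': True
    have "measure (P x) (space M - A) \<ge> measure \<nu> (space M - A)"
      using minor[OF True, of "space M - A"] A True' by simp
    then have "?r = 0"
      using r True' Px.prob_compl[of A] N.prob_compl[of A] A x by (simp add: space_P sets_P)
    then show ?thesis by simp
  qed simp
  then have "coin_weight False * ennreal (?r / (1 - \<epsilon>)) = ennreal ?r"
    using eps r by (simp flip: ennreal_mult')
  also have "ennreal ?r = emeasure (taboo_kernel x) A"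
    using True x A eps by (simp add: emeasure_taboo_kernel Px.emeasure_eq_measure
        N.emeasure_eq_measure ennreal_minus flip: ennreal_mult')
  finally show ?thesis using True by (simp add: killed_mass_def)
qed

end

section \<open>The return time\<close>

lemma Suc_le_return_time:
  "enat (Suc n) \<le> return_time Z \<alpha> \<omega> \<longleftrightarrow> (\<forall>i\<in>{1..n}. Z i \<omega> \<notin> \<alpha>)"
  by (auto simp: return_time_def le_INF_iff not_less_eq_eq[symmetric])

text \<open>The index set of the infimum depends on \<omega>. Giving the value \<infinity> to times
  off \<alpha> makes it an infimum over a fixed countable set.\<close>

lemma measurable_return_time:
  assumes Z: "\<And>n. Z n \<in> \<Omega> \<rightarrow>\<^sub>M S" and \<alpha>: "\<alpha> \<in> sets S"
  shows "return_time Z \<alpha> \<in> \<Omega> \<rightarrow>\<^sub>M count_space UNIV"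
proof -
  have "return_time Z \<alpha> = (\<lambda>\<omega>. INF n\<in>{1..}. if Z n \<omega> \<in> \<alpha> then enat n else \<infinity>)"
  proof (intro ext antisym)
    fix \<omega>
    show "return_time Z \<alpha> \<omega> \<le> (INF n\<in>{1..}. if Z n \<omega> \<in> \<alpha> then enat n else \<infinity>)"
      unfolding return_time_def by (intro INF_greatest) (auto intro: INF_lower)
    show "(INF n\<in>{1..}. if Z n \<omega> \<in> \<alpha> then enat n else \<infinity>) \<le> return_time Z \<alpha> \<omega>"
      unfolding return_time_def
    proof (rule INF_greatest)
      fix n assume "n \<in> {n. 1 \<le> n \<and> Z n \<omega> \<in> \<alpha>}"
      then show "(INF n\<in>{1..}. if Z n \<omega> \<in> \<alpha> then enat n else \<infinity>) \<le> enat n"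
        by (intro INF_lower2[of n]) simp_all
    qed
  qed
  moreover have "(\<lambda>\<omega>. if Z n \<omega> \<in> \<alpha> then enat n else \<infinity>) \<in> \<Omega> \<rightarrow>\<^sub>M count_space UNIV" for n
  proof -
    have "{\<omega>\<in>space \<Omega>. Z n \<omega> \<in> \<alpha>} = Z n -` \<alpha> \<inter> space \<Omega>" by blast
    then show ?thesis using measurable_sets[OF Z \<alpha>] by (intro measurable_If) simp_all
  qed
  ultimately show ?thesis by (simp only:) (intro measurable_INF, simp_all)
qed

section \<open>The split chain up to its return to the atom\<close>

locale split_chain = minorized_kernel M P C \<epsilon> \<nu>
  for M :: "'a measure" and P C \<epsilon> \<nu> +
  fixes \<Omega> :: "'w measure" and Z :: "nat \<Rightarrow> 'w \<Rightarrow> 'a \<times> bool"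
  assumes chain: "markov_chain \<Omega> Z (M \<Otimes>\<^sub>M count_space UNIV) (split_kernel P C \<epsilon> \<nu>)"
begin

abbreviation "\<alpha> \<equiv> C \<times> {True}"

text \<open>The start in \<alpha> is part of the event, so that the Markov property under \<Omega>
  applies before any conditioning. Time n + 1 is left free: this is the event \<tau> \<ge> n +
  1.\<close>

definition no_return :: "nat \<Rightarrow> 'w set" where
  "no_return n = {\<omega>\<in>space \<Omega>. Z 0 \<omega> \<in> \<alpha> \<and> (\<forall>i\<in>{1..n}. Z i \<omega> \<notin> \<alpha>)}"

lemma measurable_Z [measurable]: "Z n \<in> \<Omega> \<rightarrow>\<^sub>M M \<Otimes>\<^sub>M count_space UNIV"
  using chain by (simp add: markov_chain_def)

lemma fst_Z: "\<omega> \<in> space \<Omega> \<Longrightarrow> fst (Z n \<omega>) \<in> space M"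
  using measurable_space[OF measurable_Z[of n]] by (force simp: space_pair_measure)

lemma sets_atom [measurable]: "\<alpha> \<in> sets (M \<Otimes>\<^sub>M count_space UNIV)"
  by simp

lemma sets_no_return [measurable]: "no_return n \<in> sets \<Omega>"
  unfolding no_return_def by measurable

lemma no_return_Suc: "no_return (Suc n) = {\<omega>\<in>no_return n. Z (Suc n) \<omega> \<notin> \<alpha>}"
  by (auto simp: no_return_def atLeastAtMostSuc_conv)

text \<open>The event depends on \<open>Z 0\<close> to \<open>Z n\<close> only, hence is the
  preimage of a set \<open>H\<close> of finite histories, to which the Markov property
  applies.\<close>

lemma no_return_step:
  assumes A: "A \<in> sets M"
  shows "emeasure \<Omega> {\<omega>\<in>no_return n. fst (Z (Suc n) \<omega>) \<in> A \<and> snd (Z (Suc n) \<omega>) = e} =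
    (\<integral>\<^sup>+\<omega>. indicator (no_return n) \<omega> * emeasure (split_kernel P C \<epsilon> \<nu> (Z n \<omega>)) (A \<times> {e}) \<partial>\<Omega>)"
proof -
  let ?S = "M \<Otimes>\<^sub>M count_space (UNIV :: bool set)"
  let ?\<Pi> = "Pi\<^sub>M {..n} (\<lambda>_. ?S)"
  define H where "H = {z\<in>space ?\<Pi>. z 0 \<in> \<alpha> \<and> (\<forall>i\<in>{1..n}. z i \<notin> \<alpha>)}"
  have H: "H \<in> sets ?\<Pi>"
  proof -
    have c: "{z\<in>space ?\<Pi>. z i \<in> \<alpha>} \<in> sets ?\<Pi>" if "i \<in> {..n}" for i
      using measurable_sets[OF measurable_component_singleton[OF that, of "\<lambda>_. ?S"] sets_atom]
      by (simp add: vimage_def Int_def conj_commute)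
    show ?thesis
      unfolding H_def
    proof (intro sets.sets_Collect_conj sets.sets_Collect_finite_All sets.sets_Collect_neg)
      show "{z\<in>space ?\<Pi>. z 0 \<in> \<alpha>} \<in> sets ?\<Pi>" by (rule c) simp
      show "{z\<in>space ?\<Pi>. z i \<in> \<alpha>} \<in> sets ?\<Pi>" if "i \<in> {1..n}" for i using that by (intro c) simp
    qed simp
  qed
  have mem: "(\<lambda>i\<in>{..n}. Z i \<omega>) \<in> H \<longleftrightarrow> \<omega> \<in> no_return n" if "\<omega> \<in> space \<Omega>" for \<omega>
    using that measurable_space[OF measurable_Z that]
    by (auto simp: H_def no_return_def space_PiM PiE_iff)
  have "{\<omega>\<in>no_return n. fst (Z (Suc n) \<omega>) \<in> A \<and> snd (Z (Suc n) \<omega>) = e} =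
      {\<omega>\<in>space \<Omega>. (\<lambda>i\<in>{..n}. Z i \<omega>) \<in> H \<and> Z (Suc n) \<omega> \<in> A \<times> {e}}"
    using mem by (auto simp: mem_Times_iff no_return_def)
  moreover have "A \<times> {e} \<in> sets ?S" using A by simp
  ultimately have "emeasure \<Omega> {\<omega>\<in>no_return n. fst (Z (Suc n) \<omega>) \<in> A \<and> snd (Z (Suc n) \<omega>) = e} =
      (\<integral>\<^sup>+\<omega>. indicator H (\<lambda>i\<in>{..n}. Z i \<omega>) * emeasure (split_kernel P C \<epsilon> \<nu> (Z n \<omega>)) (A \<times> {e}) \<partial>\<Omega>)"
    using chain H unfolding markov_chain_def by simp
  also have "\<dots> = (\<integral>\<^sup>+\<omega>. indicator (no_return n) \<omega> *
      emeasure (split_kernel P C \<epsilon> \<nu> (Z n \<omega>)) (A \<times> {e}) \<partial>\<Omega>)"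
    by (intro nn_integral_cong) (simp add: mem indicator_def)
  finally show ?thesis .
qed

text \<open>Out of \<alpha> the next position has law \<nu> with an independent coin. Later, paths
  in \<alpha> are killed and the split kernel draws a fresh coin, so averaging over the previous
  coin turns one step into the taboo kernel. That average needs the induction hypothesis for both
  levels.\<close>

lemma emeasure_no_return:
  assumes A: "A \<in> sets M"
  shows "emeasure \<Omega> {\<omega>\<in>no_return n. fst (Z (Suc n) \<omega>) \<in> A \<and> snd (Z (Suc n) \<omega>) = e} =
    emeasure \<Omega> (no_return 0) * coin_weight e * emeasure (taboo_law n) A"
  using A
proof (induction n arbitrary: A e)
  case 0
  have "emeasure \<Omega> {\<omega>\<in>no_return 0. fst (Z (Suc 0) \<omega>) \<in> A \<and> snd (Z (Suc 0) \<omega>) = e} =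
      (\<integral>\<^sup>+\<omega>. (coin_weight e * emeasure \<nu> A) * indicator (no_return 0) \<omega> \<partial>\<Omega>)"
    unfolding no_return_step[OF 0]
  proof (rule nn_integral_cong)
    fix \<omega> assume w: "\<omega> \<in> space \<Omega>"
    show "indicator (no_return 0) \<omega> * emeasure (split_kernel P C \<epsilon> \<nu> (Z 0 \<omega>)) (A \<times> {e}) =
        coin_weight e * emeasure \<nu> A * indicator (no_return 0) \<omega>"
    proof (cases "\<omega> \<in> no_return 0")
      case True
      then have "emeasure (split_kernel P C \<epsilon> \<nu> (Z 0 \<omega>)) (A \<times> {e}) = coin_weight e * emeasure \<nu> A"
        using emeasure_split_kernel_atom[OF fst_Z[OF w] 0, of 0 "snd (Z 0 \<omega>)" e]
        by (simp only: no_return_def prod.collapse mem_Collect_eq)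
      then show ?thesis using True by simp
    qed simp
  qed
  also have "\<dots> = emeasure \<Omega> (no_return 0) * coin_weight e * emeasure \<nu> A"
    by (subst nn_integral_cmult_indicator) (simp_all add: ac_simps)
  finally show ?case by simp
next
  case (Suc n)
  let ?a = "emeasure \<Omega> (no_return 0)" and ?g = "killed_mass A"
  let ?E = "\<lambda>d. {\<omega>\<in>no_return n. snd (Z (Suc n) \<omega>) = d}"
  note g = measurable_killed_mass[OF Suc.prems]
  have fst_meas [measurable]: "(\<lambda>\<omega>. fst (Z (Suc n) \<omega>)) \<in> \<Omega> \<rightarrow>\<^sub>M M" by measurable
  have E: "?E d \<in> sets \<Omega>" for d
  proof -
    have "(\<lambda>\<omega>. snd (Z (Suc n) \<omega>)) \<in> \<Omega> \<rightarrow>\<^sub>M count_space UNIV" by measurable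
    from measurable_sets[OF this, of "{d}"]
    have "no_return n \<inter> ((\<lambda>\<omega>. snd (Z (Suc n) \<omega>)) -` {d} \<inter> space \<Omega>) \<in> sets \<Omega>" by auto
    moreover have "?E d = no_return n \<inter> ((\<lambda>\<omega>. snd (Z (Suc n) \<omega>)) -` {d} \<inter> space \<Omega>)"
      by (auto simp: no_return_def)
    ultimately show ?thesis by simp
  qed
  \<comment> \<open>The induction hypothesis as an equality of measures, so that
    \<open>killed_mass\<close> can be integrated against it; the indicator density restricts
    \<Omega> to \<open>?E d\<close>.\<close>
  have law: "distr (density \<Omega> (indicator (?E d))) M (\<lambda>\<omega>. fst (Z (Suc n) \<omega>)) =
      scale_measure (?a * coin_weight d) (taboo_law n)" (is "?L = ?R") for d
  proof (rule measure_eqI)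
    fix B assume "B \<in> sets ?L"
    then have B [measurable]: "B \<in> sets M" by simp
    have "emeasure ?L B = emeasure \<Omega> (?E d \<inter> ((\<lambda>\<omega>. fst (Z (Suc n) \<omega>)) -` B \<inter> space \<Omega>))"
      using E measurable_sets[OF fst_meas B] by (simp add: emeasure_distr emeasure_restricted)
    also have "?E d \<inter> ((\<lambda>\<omega>. fst (Z (Suc n) \<omega>)) -` B \<inter> space \<Omega>) =
        {\<omega>\<in>no_return n. fst (Z (Suc n) \<omega>) \<in> B \<and> snd (Z (Suc n) \<omega>) = d}"
      by (auto simp: no_return_def)
    finally show "emeasure ?L B = emeasure ?R B" using Suc.IH[OF B] by simp
  qed simp
  have int: "(\<integral>\<^sup>+\<omega>. indicator (?E d) \<omega> * ?g d (fst (Z (Suc n) \<omega>)) \<partial>\<Omega>) =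
      ?a * (coin_weight d * (\<integral>\<^sup>+x. ?g d x \<partial>taboo_law n))" for d
  proof -
    have "(\<integral>\<^sup>+\<omega>. indicator (?E d) \<omega> * ?g d (fst (Z (Suc n) \<omega>)) \<partial>\<Omega>) =
        (\<integral>\<^sup>+x. ?g d x \<partial>distr (density \<Omega> (indicator (?E d))) M (\<lambda>\<omega>. fst (Z (Suc n) \<omega>)))"
      using E g measurable_compose[OF fst_meas g] by (simp add: nn_integral_distr nn_integral_density)
    then show ?thesis
      using g unfolding law by (simp add: nn_integral_scale_measure mult.assoc cong: measurable_cong_sets)
  qed
  have meas: "(\<lambda>\<omega>. indicator (?E d) \<omega> * ?g d (fst (Z (Suc n) \<omega>))) \<in> borel_measurable \<Omega>" for d
    using E measurable_compose[OF fst_meas g] by (intro borel_measurable_times_ennreal) simp_all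
  have g': "?g d \<in> borel_measurable (taboo_law n)" for d
    using g by (simp cong: measurable_cong_sets)
  have "emeasure \<Omega> {\<omega>\<in>no_return (Suc n). fst (Z (Suc (Suc n)) \<omega>) \<in> A \<and> snd (Z (Suc (Suc n)) \<omega>) = e} =
      (\<integral>\<^sup>+\<omega>. coin_weight e * (indicator (?E True) \<omega> * ?g True (fst (Z (Suc n) \<omega>)) +
        indicator (?E False) \<omega> * ?g False (fst (Z (Suc n) \<omega>))) \<partial>\<Omega>)"
    unfolding no_return_step[OF Suc.prems]
  proof (rule nn_integral_cong)
    fix \<omega> assume w: "\<omega> \<in> space \<Omega>"
    obtain x d where Z: "Z (Suc n) \<omega> = (x, d)" by (cases "Z (Suc n) \<omega>")
    then have x: "x \<in> space M" using fst_Z[OF w, of "Suc n"] by simp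
    show "indicator (no_return (Suc n)) \<omega> * emeasure (split_kernel P C \<epsilon> \<nu> (Z (Suc n) \<omega>)) (A \<times> {e}) =
      coin_weight e * (indicator (?E True) \<omega> * ?g True (fst (Z (Suc n) \<omega>)) +
        indicator (?E False) \<omega> * ?g False (fst (Z (Suc n) \<omega>)))"
    \<comment> \<open>In the second case both sides are 0: off \<open>no_return n\<close> through
      the indicators, on \<alpha> because \<open>killed_mass\<close> vanishes there.\<close>
    proof (cases "\<omega> \<in> no_return n \<and> (x, d) \<notin> \<alpha>")
      case True
      then have "\<omega> \<in> no_return (Suc n)" by (simp add: no_return_Suc Z)
      then show ?thesis
        using True emeasure_split_kernel_outside[OF x Suc.prems, of d e] Z by (cases d) simp_all
    next
      case False
      then show ?thesis by (cases d) (auto simp: no_return_Suc Z killed_mass_def split: split_indicator)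
    qed
  qed
  also have "\<dots> = coin_weight e * (?a * (coin_weight True * (\<integral>\<^sup>+x. ?g True x \<partial>taboo_law n)) +
      ?a * (coin_weight False * (\<integral>\<^sup>+x. ?g False x \<partial>taboo_law n)))"
    using meas by (simp only: nn_integral_cmult nn_integral_add borel_measurable_add int)
  also have "\<dots> = ?a * coin_weight e *
      (\<integral>\<^sup>+x. coin_weight True * ?g True x + coin_weight False * ?g False x \<partial>taboo_law n)"
    using g' by (simp only: nn_integral_add nn_integral_cmult borel_measurable_times_ennreal
        borel_measurable_const) (simp only: distrib_left ac_simps)
  also have "(\<integral>\<^sup>+x. coin_weight True * ?g True x + coin_weight False * ?g False x \<partial>taboo_law n) =
      (\<integral>\<^sup>+x. emeasure (taboo_kernel x) A \<partial>taboo_law n)"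
    by (intro nn_integral_cong killed_mass_taboo_kernel Suc.prems) simp
  also have "\<dots> = (\<integral>\<^sup>+x. \<integral>\<^sup>+y. indicator A y \<partial>taboo_kernel x \<partial>taboo_law n)"
    using Suc.prems by (intro nn_integral_cong) (simp add: sets_taboo_kernel)
  also have "\<dots> = (\<integral>\<^sup>+x. indicator A x \<partial>taboo_law (Suc n))"
    using Suc.prems by (intro nn_integral_taboo_law_Suc[symmetric]) simp
  also have "\<dots> = emeasure (taboo_law (Suc n)) A" using Suc.prems
    by (intro nn_integral_indicator) (simp only: sets_taboo_law)
  finally show ?case .
qed

text \<open>Summing over the coin at time n + 1 removes its weight, and conditioning divides out the
  mass of \<open>no_return 0\<close>.\<close>

lemma emeasure_start_in:
  assumes start: "emeasure \<Omega> {\<omega>\<in>space \<Omega>. Z 0 \<omega> \<in> \<alpha>} \<noteq> 0" and A: "A \<in> sets M"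
  shows "emeasure (start_in \<Omega> Z \<alpha>)
      {\<omega>\<in>space \<Omega>. fst (Z (Suc n) \<omega>) \<in> A \<and> enat (Suc n) \<le> return_time Z \<alpha> \<omega>} =
    emeasure (taboo_law n) A"
proof -
  interpret prob_space \<Omega> using chain by (simp add: markov_chain_def)
  let ?B = "\<lambda>e. {\<omega>\<in>no_return n. fst (Z (Suc n) \<omega>) \<in> A \<and> snd (Z (Suc n) \<omega>) = e}"
  let ?D = "{\<omega>\<in>space \<Omega>. fst (Z (Suc n) \<omega>) \<in> A \<and> enat (Suc n) \<le> return_time Z \<alpha> \<omega>}"
  have nr: "{\<omega>\<in>space \<Omega>. Z 0 \<omega> \<in> \<alpha>} = no_return 0" by (simp add: no_return_def)
  have B: "?B e \<in> sets \<Omega>" for e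
  proof -
    have "?B e = no_return n \<inter> (Z (Suc n) -` (A \<times> {e}) \<inter> space \<Omega>)"
      by (auto simp: no_return_def mem_Times_iff)
    moreover have "Z (Suc n) -` (A \<times> {e}) \<inter> space \<Omega> \<in> sets \<Omega>"
      using A by (intro measurable_sets[OF measurable_Z]) simp
    ultimately show ?thesis by simp
  qed
  have D: "?D \<in> sets \<Omega>"
    unfolding Suc_le_return_time using A by measurable
  have "emeasure \<Omega> (no_return 0 \<inter> ?D) = emeasure \<Omega> (?B True \<union> ?B False)"
    by (intro arg_cong[where f = "emeasure \<Omega>"]) (auto simp: no_return_def Suc_le_return_time)
  also have "\<dots> = emeasure \<Omega> (?B True) + emeasure \<Omega> (?B False)"
    by (intro plus_emeasure[symmetric] B) blast
  also have "\<dots> = emeasure \<Omega> (no_return 0) * emeasure (taboo_law n) A *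
      (coin_weight True + coin_weight False)"
    unfolding emeasure_no_return[OF A] by (simp only: distrib_left ac_simps)
  finally have "emeasure \<Omega> (no_return 0 \<inter> ?D) = emeasure (taboo_law n) A * emeasure \<Omega> (no_return 0)"
    unfolding coin_weight_sum by (simp add: mult.commute)
  then show ?thesis
    unfolding start_in_def nr using start[unfolded nr] D
    by (simp add: ennreal_mult_divide_eq)
qed

text \<open>The tail formula for the mean, where \<tau> > n is the event \<tau> \<ge> n + 1.\<close>

lemma mean_return_time_eq:
  assumes start: "emeasure \<Omega> {\<omega>\<in>space \<Omega>. Z 0 \<omega> \<in> \<alpha>} \<noteq> 0"
  shows "mean_return_time \<Omega> Z \<alpha> = (\<Sum>n. emeasure (taboo_law n) (space M))"
proof -
  have "return_time Z \<alpha> \<in> start_in \<Omega> Z \<alpha> \<rightarrow>\<^sub>M count_space UNIV"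
    using measurable_return_time[OF measurable_Z sets_atom] by (simp add: start_in_def)
  then have "mean_return_time \<Omega> Z \<alpha> =
      (\<Sum>n. emeasure (start_in \<Omega> Z \<alpha>) {\<omega>\<in>space (start_in \<Omega> Z \<alpha>). enat n < return_time Z \<alpha> \<omega>})"
    unfolding mean_return_time_def by (rule nn_integral_enat_function)
  also have "\<dots> = (\<Sum>n. emeasure (taboo_law n) (space M))"
  proof (intro suminf_cong)
    fix n
    have "{\<omega>\<in>space (start_in \<Omega> Z \<alpha>). enat n < return_time Z \<alpha> \<omega>} =
      {\<omega>\<in>space \<Omega>. fst (Z (Suc n) \<omega>) \<in> space M \<and> enat (Suc n) \<le> return_time Z \<alpha> \<omega>}"
      using fst_Z by (auto simp: start_in_def Suc_ile_eq)
    then show "emeasure (start_in \<Omega> Z \<alpha>) {\<omega>\<in>space (start_in \<Omega> Z \<alpha>). enat n < return_time Z \<alpha> \<omega>} =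
        emeasure (taboo_law n) (space M)"
      using emeasure_start_in[OF start sets.top] by simp
  qed
  finally show ?thesis .
qed

text \<open>The probability of \<tau> \<ge> n + 1 cancels between the conditional law and the
  weight. If it is 0, the left side is 0 by the convention for division and the right side by
  monotonicity.\<close>

lemma tail_law_times_tail_weight:
  assumes start: "emeasure \<Omega> {\<omega>\<in>space \<Omega>. Z 0 \<omega> \<in> \<alpha>} \<noteq> 0" and A: "A \<in> sets M"
  shows "tail_law \<Omega> Z \<alpha> (Suc n) A * tail_weight \<Omega> Z \<alpha> (Suc n) =
    measure (taboo_law n) A / enn2real (\<Sum>n. emeasure (taboo_law n) (space M))"
proof -
  have sp: "space (start_in \<Omega> Z \<alpha>) = space \<Omega>" by (simp add: start_in_def)
  have 1: "\<P>(\<omega> in start_in \<Omega> Z \<alpha>. fst (Z (Suc n) \<omega>) \<in> B \<and> enat (Suc n) \<le> return_time Z \<alpha> \<omega>) =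
      measure (taboo_law n) B" if "B \<in> sets M" for B
    using emeasure_start_in[OF start that] by (simp only: measure_def sp)
  have "{\<omega>\<in>space (start_in \<Omega> Z \<alpha>). enat (Suc n) \<le> return_time Z \<alpha> \<omega>} =
      {\<omega>\<in>space (start_in \<Omega> Z \<alpha>). fst (Z (Suc n) \<omega>) \<in> space M \<and> enat (Suc n) \<le> return_time Z \<alpha> \<omega>}"
    using fst_Z by (auto simp: sp)
  then have 2: "\<P>(\<omega> in start_in \<Omega> Z \<alpha>. enat (Suc n) \<le> return_time Z \<alpha> \<omega>) =
      measure (taboo_law n) (space M)"
    using 1[OF sets.top] by (simp only:)
  \<comment> \<open>As \<open>measure\<close> sends infinite mass to 0, finiteness has to be known
    first; it comes from the conditional probability measure.\<close>
  have "measure (taboo_law n) A = 0" if zero: "measure (taboo_law n) (space M) = 0"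
  proof -
    interpret Q: prob_space "start_in \<Omega> Z \<alpha>"
    proof -
      interpret prob_space \<Omega> using chain by (simp add: markov_chain_def)
      show "prob_space (start_in \<Omega> Z \<alpha>)"
        unfolding start_in_def by (rule prob_space_uniform_measure[OF start]) simp
    qed
    have "emeasure (taboo_law n) A \<le> emeasure (taboo_law n) (space M)"
      using emeasure_space[of "taboo_law n" A] by simp
    moreover have "emeasure (taboo_law n) (space M) \<noteq> \<infinity>"
      unfolding emeasure_start_in[OF start sets.top, of n, symmetric] by simp
    ultimately show ?thesis
      using zero by (simp add: measure_def enn2real_eq_0_iff)
  qed
  then show ?thesis
    unfolding tail_law_def tail_weight_def cond_prob_def 1[OF A] 2 mean_return_time_eq[OF start]
    by simp
qed

end

section \<open>The invariant probability as a mixture\<close>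

theorem theorem1:
  fixes M :: "'a measure" and P :: "'a \<Rightarrow> 'a measure" and \<pi> \<nu> :: "'a measure"
    and C :: "'a set" and \<epsilon> :: real
    and \<Omega> :: "'w measure" and Z :: "nat \<Rightarrow> 'w \<Rightarrow> 'a \<times> bool"
  assumes kernel: "P \<in> M \<rightarrow>\<^sub>M prob_algebra M"
    and invariant: "invariant_prob M P \<pi>"
    and harris: "harris_recurrent M P \<pi>"
    and C: "C \<in> sets M" "measure \<pi> C > 0"
    and eps: "\<epsilon> > 0"
    and nu: "\<nu> \<in> space (prob_algebra M)"
    and minorization: "\<And>x A. x \<in> C \<Longrightarrow> A \<in> sets M \<Longrightarrow> measure (P x) A \<ge> \<epsilon> * measure \<nu> A"
    and split_chain: "markov_chain \<Omega> Z (M \<Otimes>\<^sub>M count_space UNIV) (split_kernel P C \<epsilon> \<nu>)"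
    and start: "\<P>(\<omega> in \<Omega>. Z 0 \<omega> \<in> C \<times> {True}) > 0"
    and A: "A \<in> sets M"
  shows "(\<lambda>n. tail_law \<Omega> Z (C \<times> {True}) (Suc n) A * tail_weight \<Omega> Z (C \<times> {True}) (Suc n))
           sums measure \<pi> A"
proof -
  have \<pi>: "prob_space \<pi>" "sets \<pi> = sets M"
    using invariant by (auto simp: invariant_prob_def space_prob_algebra)
  interpret \<pi>: prob_space \<pi> by (rule \<pi>)
  have C0: "emeasure \<pi> C > 0" using C(2) by (simp add: \<pi>.emeasure_eq_measure)
  \<comment> \<open>Total masses are compared at a point of \<open>C\<close>, which exists because
    \<pi>(C) > 0.\<close>
  have "\<epsilon> \<le> 1"
  proof -
    obtain x where x: "x \<in> C" using C(2) by (cases "C = {}") auto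
    then have "x \<in> space M" using sets.sets_into_space[OF C(1)] by blast
    then have "prob_space (P x)" using measurable_space[OF kernel] by (simp add: space_prob_algebra)
    then have "measure (P x) (space M) \<le> 1" by (rule prob_space.prob_le_1)
    moreover have "measure \<nu> (space M) = 1"
      using nu prob_space.prob_space[of \<nu>] by (auto simp: space_prob_algebra dest: sets_eq_imp_space_eq)
    ultimately show ?thesis using minorization[OF x sets.top] by simp
  qed
  then interpret split_chain M P C \<epsilon> \<nu> \<Omega> Z
    using assms by unfold_locales auto
  let ?a = "\<lambda>n. emeasure (taboo_law n)" and ?c = "ennreal \<epsilon> * emeasure \<pi> C"
  have sum: "emeasure \<pi> B = ?c * (\<Sum>n. ?a n B)" if "B \<in> sets M" for B
    using invariant_eq_suminf_taboo_law[OF invariant _ C0 that] harris by (simp add: harris_recurrent_def)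
  define s where "s = (\<Sum>n. ?a n (space M))"
  \<comment> \<open>Evaluating the representation of \<pi> on the whole space identifies the mean
    return time \<open>s\<close> as 1 / c.\<close>
  have cs: "?c * s = 1"
    using sum[OF sets.top] \<pi>.emeasure_space_1 sets_eq_imp_space_eq[OF \<pi>(2)] by (simp add: s_def)
  have c0: "?c \<noteq> 0" using C0 eps by auto
  have s: "s \<noteq> \<infinity>" "s \<noteq> 0" using cs c0 by (auto simp: ennreal_mult_top)
  have le: "?a n B \<le> s" for n B
  proof -
    have "?a n B \<le> ?a n (space M)" using emeasure_space[of "taboo_law n" B] by simp
    also have "\<dots> \<le> s"
      using sum_le_suminf[of "\<lambda>n. ?a n (space M)" "{n}"] by (simp add: s_def summableI)
    finally show ?thesis .
  qed
  \<comment> \<open>The weights divide real numbers, the series of measures is in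
    \<open>ennreal\<close>; the quotients agree since \<open>s\<close> is finite and
    nonzero.\<close>
  have ratio: "ennreal (measure (taboo_law n) A / enn2real s) = ?a n A / s" for n
  proof -
    have "?a n A = ennreal (measure (taboo_law n) A)"
      using le[of n A] s by (intro emeasure_eq_ennreal_measure) (auto simp: top_unique)
    moreover have "s = ennreal (enn2real s)" "0 < enn2real s"
      using s by (auto simp: less_top enn2real_positive_iff zero_less_iff_neq_zero)
    ultimately show ?thesis by (metis divide_ennreal measure_nonneg)
  qed
  \<comment> \<open>Inserting the factor c s = 1 supplies the c of the representation, and
    \<open>s\<close> cancels.\<close>
  have "(\<Sum>n. ?a n A / s) = (\<Sum>n. ?a n A) * (?c * s) / s"
    unfolding cs by simp
  also have "\<dots> = emeasure \<pi> A"
    using s ennreal_mult_divide_eq[of s "emeasure \<pi> A"] unfolding sum[OF A] by (simp add: ac_simps)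
  finally have "(\<lambda>n. ennreal (measure (taboo_law n) A / enn2real s)) sums ennreal (measure \<pi> A)"
    using summable_sums[OF summableI, of "\<lambda>n. ?a n A / s"] unfolding ratio
    by (simp add: \<pi>.emeasure_eq_measure)
  then have "(\<lambda>n. measure (taboo_law n) A / enn2real s) sums measure \<pi> A"
    by (subst (asm) sums_ennreal) simp_all
  moreover have "emeasure \<Omega> {\<omega>\<in>space \<Omega>. Z 0 \<omega> \<in> C \<times> {True}} \<noteq> 0"
    using start by (auto simp: measure_def)
  ultimately show ?thesis
    unfolding s_def by (simp only: tail_law_times_tail_weight A not_False_eq_True)
qed

end
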